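(* Let $K$ be a simplicial complex and let $\mathscr{A}=(K_i\subseteq K)_{i\in I}$ be a good cover of $K$ by subcomplexes. Then the natural maps $\rho_S\colon\operatorname{Blowup}(|\mathscr{A}|)\to|K|$ and $\rho_N\colon\operatorname{Blowup}(|\mathscr{A}|)\to|\operatorname{Nrv}(\mathscr{A})|$ are homotopy equivalences.
   Context: $|\cdot|$ denotes geometric realization of simplicial complexes. For a cover $\mathscr{A}=(K_i)_{i\in I}$ of $K$ by subcomplexes, $|\mathscr{A}|=(|K_i|)_{i\in I}$ is the associated cover of $|K|$, and $K_J=\bigcap_{i\in J}K_i$ for $J\subseteq I$. The cover is good if all non-empty finite intersections of cover elements are contractible (a simplicial complex is called contractible if its geometric realization is). No finiteness is assumed on $K$ or $I$. For a family $\mathscr{U}=(U_i)_{i\in I}$ of sets, the nerve $\operatorname{Nrv}(\mathscr{U})$ is the abstract simplicial complex whose simplices are the finite subsets $J\subseteq I$ with $U_J=\bigcap_{i\in J}U_i\neq\emptyset$ (simplices are understood to be non-empty). In particular $\operatorname{Nrv}(\mathscr{A})=\operatorname{Nrv}(|\mathscr{A}|)$. For a non-empty finite set $J$, $|J|$ denotes the geometric realization of the full simplex with vertex set $J$. For a cover $\mathscr{U}=(U_i)_{i\in I}$ of a space $X$, the blowup complex is the quotient space $$\operatorname{Blowup}(\mathscr{U})=\Big(\bigsqcup_{J\in\operatorname{Nrv}(\mathscr{U})}U_J\times|J|\Big)\big/\sim,$$ where $\sim$ identifies, for all $J\subseteq J'$ in $\operatorname{Nrv}(\mathscr{U})$,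 the spaces $U_J\times|J|$ and $U_{J'}\times|J'|$ along their common subspace $U_{J'}\times|J|$. The projections $U_J\times|J|\to U_J\subseteq X$ induce the natural map $\rho_S\colon\operatorname{Blowup}(\mathscr{U})\to X$, and the projections $U_J\times|J|\to|J|\subseteq|\operatorname{Nrv}(\mathscr{U})|$ induce the natural map $\rho_N\colon\operatorname{Blowup}(\mathscr{U})\to|\operatorname{Nrv}(\mathscr{U})|$. *)

theory Defs
  imports "HOL-Analysis.Analysis"
begin

text \<open>
  The library constant \<open>simplicial_complex\<close> describes finite geometric complexes in a Euclidean
  space. Here complexes are abstract, of arbitrary cardinality and dimension, and given by their
  set of (non-empty) simplices; the vertex set is the union of all simplices.
\<close>

definition abstract_simplicial_complex :: "'a set set \<Rightarrow> bool" where
  "abstract_simplicial_complex K \<longleftrightarrow>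
     (\<forall>s\<in>K. finite s \<and> s \<noteq> {}) \<and> (\<forall>s\<in>K. \<forall>t. t \<noteq> {} \<and> t \<subseteq> s \<longrightarrow> t \<in> K)"

definition subcomplex :: "'a set set \<Rightarrow> 'a set set \<Rightarrow> bool" where
  "subcomplex L K \<longleftrightarrow> abstract_simplicial_complex L \<and> L \<subseteq> K"

definition full_simplex :: "'a set \<Rightarrow> 'a set set" where
  "full_simplex J = {s. s \<subseteq> J \<and> s \<noteq> {}}"

text \<open>
  Points are given by barycentric coordinates. The functions in \<open>closed_simplex s\<close> vanish outside
  the finite set \<open>s\<close>, so the product topology induces the Euclidean topology on it. A complex carries
  the weak topology determined by its closed simplices; for infinite complexes it is in general
  strictly finer than the subspace topology of the product.
\<close>

definition closed_simplex :: "'a set \<Rightarrow> ('a \<Rightarrow> real) set" where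
  "closed_simplex s = {p. (\<forall>v. 0 \<le> p v) \<and> (\<forall>v. v \<notin> s \<longrightarrow> p v = 0) \<and> (\<Sum>v\<in>s. p v) = 1}"

definition realization_points :: "'a set set \<Rightarrow> ('a \<Rightarrow> real) set" where
  "realization_points K = (\<Union>s\<in>K. closed_simplex s)"

definition realization :: "'a set set \<Rightarrow> ('a \<Rightarrow> real) topology" where
  "realization K = topology (\<lambda>U. U \<subseteq> realization_points K \<and>
     (\<forall>s\<in>K. openin (subtopology (powertop_real UNIV) (closed_simplex s)) (U \<inter> closed_simplex s)))"

lemma istopology_realization:
  "istopology (\<lambda>U. U \<subseteq> realization_points K \<and>
     (\<forall>s\<in>K. openin (subtopology (powertop_real UNIV) (closed_simplex s)) (U \<inter> closed_simplex s)))"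
proof -
  have 1: "S \<inter> T \<inter> closed_simplex s = (S \<inter> closed_simplex s) \<inter> (T \<inter> closed_simplex s)"
    for S T and s :: "'a set"
    by auto
  have 2: "\<Union>\<K> \<inter> closed_simplex s = (\<Union>U\<in>\<K>. U \<inter> closed_simplex s)" for \<K> and s :: "'a set"
    by auto
  show ?thesis
    unfolding istopology_def 1 2 by blast
qed

lemma openin_realization:
  "openin (realization K) U \<longleftrightarrow> U \<subseteq> realization_points K \<and>
     (\<forall>s\<in>K. openin (subtopology (powertop_real UNIV) (closed_simplex s)) (U \<inter> closed_simplex s))"
  by (simp add: realization_def istopology_realization)

lemma topspace_realization: "topspace (realization K) = realization_points K"
proof
  show "topspace (realization K) \<subseteq> realization_points K"
    using openin_realization openin_topspace by blast
  have "realization_points K \<inter> closed_simplex s = closed_simplex s" if "s \<in> K" for s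
    using that by (auto simp: realization_points_def)
  moreover have "openin (subtopology (powertop_real UNIV) (closed_simplex s)) (closed_simplex s)"
    for s :: "'a set"
    using openin_topspace[of "subtopology (powertop_real UNIV) (closed_simplex s)"] by simp
  ultimately have "openin (realization K) (realization_points K)"
    by (simp add: openin_realization)
  then show "realization_points K \<subseteq> topspace (realization K)"
    by (rule openin_subset)
qed

definition nerve :: "'i set \<Rightarrow> ('i \<Rightarrow> 'b set) \<Rightarrow> 'i set set" where
  "nerve I U = {J. J \<subseteq> I \<and> finite J \<and> J \<noteq> {} \<and> (\<Inter>i\<in>J. U i) \<noteq> {}}"

lemma abstract_simplicial_complex_nerve: "abstract_simplicial_complex (nerve I U)"
proof -
  have "t \<in> nerve I U" if "s \<in> nerve I U" "t \<noteq> {}" "t \<subseteq> s" for s t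
  proof -
    have "(\<Inter>i\<in>s. U i) \<subseteq> (\<Inter>i\<in>t. U i)" using that(3) by (rule INF_superset_mono) simp
    then show ?thesis
      using that finite_subset[OF that(3)] by (auto simp: nerve_def)
  qed
  then show ?thesis
    unfolding abstract_simplicial_complex_def
  proof (intro conjI ballI allI impI; (elim conjE)?)
    show "finite s" "s \<noteq> {}" if "s \<in> nerve I U" for s
      using that by (simp_all only: nerve_def mem_Collect_eq simp_thms)
  qed
qed

text \<open>Members of a cover may be empty, and may be repeated.\<close>

definition cover_by_subcomplexes :: "'a set set \<Rightarrow> 'i set \<Rightarrow> ('i \<Rightarrow> 'a set set) \<Rightarrow> bool" where
  "cover_by_subcomplexes K I A \<longleftrightarrow> (\<forall>i\<in>I. subcomplex (A i) K) \<and> (\<Union>i\<in>I. A i) = K"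

definition good_cover :: "'a set set \<Rightarrow> 'i set \<Rightarrow> ('i \<Rightarrow> 'a set set) \<Rightarrow> bool" where
  "good_cover K I A \<longleftrightarrow> cover_by_subcomplexes K I A \<and>
     (\<forall>J. J \<subseteq> I \<and> finite J \<and> J \<noteq> {} \<and> (\<Inter>i\<in>J. A i) \<noteq> {} \<longrightarrow>
        contractible_space (realization (\<Inter>i\<in>J. A i)))"

definition quotient_topology :: "'b topology \<Rightarrow> ('b \<times> 'b) set \<Rightarrow> 'b set topology" where
  "quotient_topology X r = topology (\<lambda>V. V \<subseteq> topspace X // r \<and> openin X (\<Union>V))"

lemma quotient_map_quotient_topology:
  assumes "equiv (topspace X) r"
  shows "quotient_map X (quotient_topology X r) (\<lambda>x. r `` {x})"
proof -
  have Int: "\<Union>(V \<inter> W) = \<Union>V \<inter> \<Union>W"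
    if "V \<subseteq> topspace X // r" "W \<subseteq> topspace X // r" for V W
    using that quotient_disj[OF assms] by blast
  have "istopology (\<lambda>V. V \<subseteq> topspace X // r \<and> openin X (\<Union>V))"
    unfolding istopology_def
  proof (intro conjI allI impI)
    fix \<K> assume "\<forall>V\<in>\<K>. V \<subseteq> topspace X // r \<and> openin X (\<Union>V)"
    then have "\<forall>V\<in>\<K>. openin X (\<Union>V)" and sub: "\<Union>\<K> \<subseteq> topspace X // r" by blast+
    moreover have "\<Union>(\<Union>\<K>) = (\<Union>V\<in>\<K>. \<Union>V)" by blast
    ultimately show "openin X (\<Union>(\<Union>\<K>))" by auto
    show "\<Union>\<K> \<subseteq> topspace X // r" by (rule sub)
  qed (auto simp: Int)
  then have op: "openin (quotient_topology X r) V \<longleftrightarrow> V \<subseteq> topspace X // r \<and> openin X (\<Union>V)" for V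
    by (simp add: quotient_topology_def)
  have top: "topspace (quotient_topology X r) = topspace X // r"
  proof
    show "topspace (quotient_topology X r) \<subseteq> topspace X // r"
      using op openin_topspace by blast
    show "topspace X // r \<subseteq> topspace (quotient_topology X r)"
      by (rule openin_subset) (simp add: op Union_quotient[OF assms])
  qed
  have pre: "{x \<in> topspace X. r `` {x} \<in> V} = \<Union>V" if "V \<subseteq> topspace X // r" for V
  proof (intro set_eqI iffI)
    fix x assume "x \<in> {x \<in> topspace X. r `` {x} \<in> V}"
    then show "x \<in> \<Union>V" using equiv_class_self[OF assms] by blast
  next
    fix x assume "x \<in> \<Union>V"
    then obtain C where C: "x \<in> C" "C \<in> V" by blast
    with that have "C \<in> topspace X // r" by blast
    then obtain y where y: "C = r `` {y}" "y \<in> topspace X" by (rule quotientE)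
    then have "(y, x) \<in> r" using C by blast
    then have "r `` {x} = C" and "x \<in> topspace X"
      using y(1) equiv_class_eq_iff[OF assms, of y x] by simp_all
    then show "x \<in> {x \<in> topspace X. r `` {x} \<in> V}"
      using C by simp
  qed
  show ?thesis
    unfolding quotient_map_def top by (auto simp: op pre quotient_def)
qed

text \<open>
  A point of the disjoint union is a triple \<open>(J, x, p)\<close> with \<open>x\<close> in the intersection \<open>U\<^sub>J\<close> and \<open>p\<close> in
  the full simplex on \<open>J\<close>. As barycentric coordinates are functions on the whole index type, a face
  of a simplex is literally a subset of it, and gluing only changes the first component. The choice
  \<open>J = J'\<close> makes the gluing relation reflexive on the disjoint union, so the transitive closure of
  its symmetric version is the generated equivalence relation.
\<close>

definition blowup_pieces ::
    "'x topology \<Rightarrow> 'i set \<Rightarrow> ('i \<Rightarrow> 'x set) \<Rightarrow> ('i set \<times> 'x \<times> ('i \<Rightarrow> real)) topology" where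
  "blowup_pieces X I U = sum_topology
     (\<lambda>J. prod_topology (subtopology X (\<Inter>i\<in>J. U i)) (realization (full_simplex J))) (nerve I U)"

definition blowup_glue ::
    "'i set \<Rightarrow> ('i \<Rightarrow> 'x set) \<Rightarrow> (('i set \<times> 'x \<times> ('i \<Rightarrow> real)) \<times> ('i set \<times> 'x \<times> ('i \<Rightarrow> real))) set" where
  "blowup_glue I U = {((J, x, p), (J', x, p)) | J J' x p.
     J \<in> nerve I U \<and> J' \<in> nerve I U \<and> J \<subseteq> J' \<and>
     x \<in> (\<Inter>i\<in>J'. U i) \<and> p \<in> realization_points (full_simplex J)}"

definition blowup_rel ::
    "'i set \<Rightarrow> ('i \<Rightarrow> 'x set) \<Rightarrow> (('i set \<times> 'x \<times> ('i \<Rightarrow> real)) \<times> ('i set \<times> 'x \<times> ('i \<Rightarrow> real))) set" where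
  "blowup_rel I U = (blowup_glue I U \<union> (blowup_glue I U)\<inverse>)\<^sup>+"

definition blowup ::
    "'x topology \<Rightarrow> 'i set \<Rightarrow> ('i \<Rightarrow> 'x set) \<Rightarrow> ('i set \<times> 'x \<times> ('i \<Rightarrow> real)) set topology" where
  "blowup X I U = quotient_topology (blowup_pieces X I U) (blowup_rel I U)"

text \<open>
  All members of an equivalence class have the same last two components; the natural maps return
  them.
\<close>

definition rho_S :: "('i set \<times> 'x \<times> ('i \<Rightarrow> real)) set \<Rightarrow> 'x" where
  "rho_S C = (THE x. \<exists>J p. (J, x, p) \<in> C)"

definition rho_N :: "('i set \<times> 'x \<times> ('i \<Rightarrow> real)) set \<Rightarrow> ('i \<Rightarrow> real)" where
  "rho_N C = (THE p. \<exists>J x. (J, x, p) \<in> C)"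

lemma topspace_blowup_pieces:
  assumes "\<forall>i\<in>I. U i \<subseteq> topspace X"
  shows "topspace (blowup_pieces X I U) =
    {(J, x, p). J \<in> nerve I U \<and> x \<in> (\<Inter>i\<in>J. U i) \<and> p \<in> realization_points (full_simplex J)}"
proof -
  have "x \<in> topspace X" if "J \<in> nerve I U" "\<forall>i\<in>J. x \<in> U i" for J x
    using that assms by (fastforce simp: nerve_def)
  then show ?thesis
    by (auto simp: blowup_pieces_def topspace_realization)
qed

lemma equiv_blowup_rel:
  fixes U :: "'i \<Rightarrow> 'x set"
  assumes "\<forall>i\<in>I. U i \<subseteq> topspace X"
  shows "equiv (topspace (blowup_pieces X I U)) (blowup_rel I U)"
proof -
  let ?T = "topspace (blowup_pieces X I U)" and ?g = "blowup_glue I U \<union> (blowup_glue I U)\<inverse>"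
  have mono: "realization_points (full_simplex J) \<subseteq> realization_points (full_simplex J')"
    if "J \<subseteq> J'" for J J' :: "'i set"
    unfolding realization_points_def using that
    by (intro UN_mono subset_refl) (auto simp: full_simplex_def)
  have T: "?T = {(J, x, p). J \<in> nerve I U \<and> x \<in> (\<Inter>i\<in>J. U i) \<and> p \<in> realization_points (full_simplex J)}"
    using assms by (rule topspace_blowup_pieces)
  have "blowup_glue I U \<subseteq> ?T \<times> ?T"
  proof
    fix q assume "q \<in> blowup_glue I U"
    then obtain J J' x p where q: "q = ((J, x, p), (J', x, p))"
      and J: "J \<in> nerve I U" "J' \<in> nerve I U" "J \<subseteq> J'" and x: "x \<in> (\<Inter>i\<in>J'. U i)"
      and p: "p \<in> realization_points (full_simplex J)"
      unfolding blowup_glue_def mem_Collect_eq by (elim exE conjE)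
    have x': "x \<in> (\<Inter>i\<in>J. U i)" using x J(3) by auto
    have p': "p \<in> realization_points (full_simplex J')" using mono[OF J(3)] p by (rule subsetD)
    have "(J, x, p) \<in> ?T" "(J', x, p) \<in> ?T"
      unfolding T using J(1,2) x x' p p' by (simp_all only: mem_Collect_eq prod.case simp_thms)
    then show "q \<in> ?T \<times> ?T" unfolding q by (rule SigmaI)
  qed
  then have "?g \<subseteq> ?T \<times> ?T" by blast
  then have "?g\<^sup>+ \<subseteq> ?T \<times> ?T" by (rule trancl_subset_Sigma)
  moreover have "(z, z) \<in> ?g" if "z \<in> ?T" for z
    using that unfolding T by (auto simp: blowup_glue_def)
  then have "refl_on ?T (?g\<^sup>+)" by (auto simp: refl_on_def)
  moreover have "sym (?g\<^sup>+)" by (intro sym_trancl sym_Un_converse)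
  ultimately show ?thesis
    unfolding blowup_rel_def by (intro equivI) auto
qed

lemma blowup_rel_same_point:
  assumes "(z, w) \<in> blowup_rel I U"
  shows "snd z = snd w"
  using assms unfolding blowup_rel_def
  by (induction rule: trancl_induct) (auto simp: blowup_glue_def)

lemma rho_class:
  assumes "\<forall>i\<in>I. U i \<subseteq> topspace X" and "(J, x, p) \<in> topspace (blowup_pieces X I U)"
  shows "rho_S (blowup_rel I U `` {(J, x, p)}) = x" and "rho_N (blowup_rel I U `` {(J, x, p)}) = p"
proof -
  have "((J, x, p), (J, x, p)) \<in> blowup_rel I U"
    using equiv_blowup_rel[OF assms(1)] assms(2) by (simp add: equiv_def refl_on_def)
  moreover have "y = x \<and> q = p" if "((J, x, p), (J', y, q)) \<in> blowup_rel I U" for J' y q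
    using blowup_rel_same_point[OF that] by simp
  ultimately show "rho_S (blowup_rel I U `` {(J, x, p)}) = x"
    and "rho_N (blowup_rel I U `` {(J, x, p)}) = p"
    unfolding rho_S_def rho_N_def Image_singleton_iff by auto
qed

lemma nerve_realization:
  assumes "\<forall>i\<in>I. abstract_simplicial_complex (A i)"
  shows "nerve I (\<lambda>i. topspace (realization (A i))) = nerve I A"
proof -
  have "(\<Inter>i\<in>J. realization_points (A i)) \<noteq> {} \<longleftrightarrow> (\<Inter>i\<in>J. A i) \<noteq> {}"
    if J: "J \<subseteq> I" "J \<noteq> {}" for J
  proof
    assume "(\<Inter>i\<in>J. realization_points (A i)) \<noteq> {}"
    then obtain p where p: "\<And>i. i \<in> J \<Longrightarrow> p \<in> realization_points (A i)" by blast
    have "{v. p v \<noteq> 0} \<in> A i" if i: "i \<in> J" for i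
    proof -
      obtain s where s: "s \<in> A i" "p \<in> closed_simplex s"
        using p[OF i] by (auto simp: realization_points_def)
      then have sub: "{v. p v \<noteq> 0} \<subseteq> s" and sum: "(\<Sum>v\<in>s. p v) = 1"
        by (auto simp: closed_simplex_def)
      have ne: "{v. p v \<noteq> 0} \<noteq> {}"
      proof
        assume "{v. p v \<noteq> 0} = {}"
        then have "(\<Sum>v\<in>s. p v) = 0" by (intro sum.neutral) blast
        then show False using sum by simp
      qed
      have "abstract_simplicial_complex (A i)" using assms J i by blast
      then have "\<forall>t. t \<noteq> {} \<and> t \<subseteq> s \<longrightarrow> t \<in> A i"
        using s(1) unfolding abstract_simplicial_complex_def by (elim conjE bspec)
      then show ?thesis
        using ne sub by (simp only: simp_thms)
    qed
    then show "(\<Inter>i\<in>J. A i) \<noteq> {}" by blast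
  next
    assume "(\<Inter>i\<in>J. A i) \<noteq> {}"
    then obtain s where s: "\<And>i. i \<in> J \<Longrightarrow> s \<in> A i" by blast
    obtain j where "j \<in> J" using J by blast
    then have "abstract_simplicial_complex (A j)" using assms J by blast
    then have "finite s" "s \<noteq> {}"
      using s[OF \<open>j \<in> J\<close>] unfolding abstract_simplicial_complex_def by simp_all
    then obtain v where "v \<in> s" "finite s" by blast
    then have "(\<lambda>w. if w = v then 1 else 0) \<in> closed_simplex s"
      by (auto simp: closed_simplex_def)
    then have "(\<lambda>w. if w = v then 1 else 0) \<in> (\<Inter>i\<in>J. realization_points (A i))"
      using s by (auto simp: realization_points_def)
    then show "(\<Inter>i\<in>J. realization_points (A i)) \<noteq> {}" by blast
  qed
  then show ?thesis
    unfolding nerve_def topspace_realization by (intro Collect_cong conj_cong refl)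
qed

text \<open>
  The library only has the relation that two spaces are homotopy equivalent, not the property of a
  given map.
\<close>

definition homotopy_equivalence_map :: "'b topology \<Rightarrow> 'c topology \<Rightarrow> ('b \<Rightarrow> 'c) \<Rightarrow> bool" where
  "homotopy_equivalence_map X Y f \<longleftrightarrow> continuous_map X Y f \<and>
     (\<exists>g. continuous_map Y X g \<and>
          homotopic_with (\<lambda>_. True) X X (g \<circ> f) id \<and>
          homotopic_with (\<lambda>_. True) Y Y (f \<circ> g) id)"

end

theory Submission
  imports Defs
begin

text \<open>
  Both maps are instances of one statement. Let \<open>R\<close> be a relation between the simplices of two
  complexes that is closed under passing to faces, and let \<open>B\<close> be the union of the cells
  \<open>|s| \<times> |t|\<close> for \<open>(s, t) \<in> R\<close> with the weak topology. If all fibres \<open>|R\<^sub>s|\<close> are contractible, then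
  the first projection from \<open>B\<close> is a homotopy equivalence. The blowup is such a \<open>B\<close>, where
  \<open>(s, J) \<in> R\<close> if \<open>s\<close> is a simplex of \<open>A\<^sub>i\<close> for all \<open>i \<in> J\<close>: over \<open>s\<close> the fibre is a full simplex, possibly
  infinite-dimensional, and over \<open>J\<close> it is the intersection of the \<open>A\<^sub>i\<close>.

  For the general statement, choose contractions \<open>h\<^sub>s\<close> of the fibres. Given a point \<open>x\<close> and a level
  \<open>\<theta>\<close> strictly between \<open>0\<close> and its largest coordinate, depending continuously on \<open>x\<close>, let \<open>q x\<close> be the
  normalization of the positive part of \<open>x - \<theta>\<close>, and let \<open>s\<^sub>0 \<subset> \<dots> \<subset> s\<^sub>k\<close> be the superlevel sets of \<open>x\<close> at the
  levels below \<open>\<theta>\<close>. Put \<open>W\<^sub>t(x, p) = h\<^bsub>s\<^sub>0\<^esub>(t a\<^sub>0, \<dots> h\<^bsub>s\<^sub>k\<^esub>(t a\<^sub>k, p))\<close>, where the time \<open>a\<^sub>j\<close> depends on the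
  length of the interval of levels with superlevel set \<open>s\<^sub>j\<close>, vanishes with it, and some \<open>a\<^sub>j\<close> equals \<open>1\<close>.
  Then \<open>W\<^sub>1(x, p)\<close> is independent of \<open>p\<close>, the map \<open>x \<mapsto> (q x, W\<^sub>1 x)\<close> is a homotopy inverse, and the
  homotopies are the straight line from \<open>x\<close> to \<open>q x\<close> followed by \<open>W\<^sub>t\<close>.
\<close>

section \<open>Coherent topologies\<close>

text \<open>The final topology for the inclusions of the cells \<open>c\<close>, each with its
  topology from \<open>T\<close>. Realizations and product complexes are both instances, so
  continuity out of either is tested cell by cell.\<close>

definition coherent_topology :: "'b topology \<Rightarrow> 'b set set \<Rightarrow> 'b topology" where
  "coherent_topology T C = topology (\<lambda>U. U \<subseteq> \<Union>C \<and> (\<forall>c\<in>C. openin (subtopology T c) (U \<inter> c)))"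

lemma openin_coherent_topology:
  "openin (coherent_topology T C) U \<longleftrightarrow> U \<subseteq> \<Union>C \<and> (\<forall>c\<in>C. openin (subtopology T c) (U \<inter> c))"
proof -
  have "istopology (\<lambda>U. U \<subseteq> \<Union>C \<and> (\<forall>c\<in>C. openin (subtopology T c) (U \<inter> c)))"
    unfolding istopology_def
  proof (intro conjI allI impI; (elim conjE)?)
    fix S U assume *: "S \<subseteq> \<Union>C" "U \<subseteq> \<Union>C" "\<forall>c\<in>C. openin (subtopology T c) (S \<inter> c)"
      "\<forall>c\<in>C. openin (subtopology T c) (U \<inter> c)"
    have "S \<inter> U \<inter> c = (S \<inter> c) \<inter> (U \<inter> c)" for c by blast
    then show "\<forall>c\<in>C. openin (subtopology T c) (S \<inter> U \<inter> c)" using * by auto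
    show "S \<inter> U \<subseteq> \<Union>C" using * by blast
  next
    fix \<K> assume *: "\<forall>S\<in>\<K>. S \<subseteq> \<Union>C \<and> (\<forall>c\<in>C. openin (subtopology T c) (S \<inter> c))"
    have "\<Union>\<K> \<inter> c = (\<Union>U\<in>\<K>. U \<inter> c)" for c by blast
    moreover have "openin (subtopology T c) (\<Union>U\<in>\<K>. U \<inter> c)" if "c \<in> C" for c
      using * that by (intro openin_Union) blast
    ultimately show "\<forall>c\<in>C. openin (subtopology T c) (\<Union>\<K> \<inter> c)" by simp
    show "\<Union>\<K> \<subseteq> \<Union>C" using * by blast
  qed
  then show ?thesis by (simp add: coherent_topology_def)
qed

lemma topspace_coherent_topology:
  assumes "\<Union>C \<subseteq> topspace T"
  shows "topspace (coherent_topology T C) = \<Union>C"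
proof
  show "topspace (coherent_topology T C) \<subseteq> \<Union>C"
    by (rule conjunct1[OF iffD1[OF openin_coherent_topology openin_topspace]])
  have "openin (subtopology T c) (\<Union>C \<inter> c)" if "c \<in> C" for c
  proof -
    have "\<Union>C \<inter> c = topspace (subtopology T c)" using assms that by auto
    then show ?thesis by (metis openin_topspace)
  qed
  then have "openin (coherent_topology T C) (\<Union>C)" by (simp add: openin_coherent_topology)
  then show "\<Union>C \<subseteq> topspace (coherent_topology T C)" by (rule openin_subset)
qed

lemma closedin_coherent_topology:
  assumes "\<Union>C \<subseteq> topspace T"
  shows "closedin (coherent_topology T C) D \<longleftrightarrow>
    D \<subseteq> \<Union>C \<and> (\<forall>c\<in>C. closedin (subtopology T c) (D \<inter> c))"
proof -
  have "(\<Union>C - D) \<inter> c = c - D \<inter> c" if "c \<in> C" for c using that by blast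
  moreover have "topspace (subtopology T c) = c" if "c \<in> C" for c using assms that by auto
  ultimately show ?thesis
    by (auto simp: closedin_def topspace_coherent_topology[OF assms] openin_coherent_topology)
qed

lemma continuous_map_coherent_topology:
  assumes "\<Union>C \<subseteq> topspace T"
    and "\<And>c. c \<in> C \<Longrightarrow> continuous_map (subtopology T c) Y f"
  shows "continuous_map (coherent_topology T C) Y f"
  unfolding continuous_map_def topspace_coherent_topology[OF assms(1)]
proof (intro conjI allI impI)
  show "f \<in> \<Union>C \<rightarrow> topspace Y"
    using assms by (fastforce simp: continuous_map_def Pi_iff)
  fix U assume U: "openin Y U"
  have "openin (subtopology T c) ({x \<in> \<Union>C. f x \<in> U} \<inter> c)" if c: "c \<in> C" for c
  proof -
    have "{x \<in> \<Union>C. f x \<in> U} \<inter> c = {x \<in> topspace (subtopology T c). f x \<in> U}"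
      using assms(1) c by auto
    then show ?thesis using assms(2)[OF c] U by (simp add: continuous_map_def)
  qed
  then show "openin (coherent_topology T C) {x \<in> \<Union>C. f x \<in> U}"
    by (auto simp: openin_coherent_topology)
qed

lemma continuous_map_cell_inclusion:
  assumes "\<Union>C \<subseteq> topspace T" and "c \<in> C"
  shows "continuous_map (subtopology T c) (coherent_topology T C) (\<lambda>x. x)"
proof -
  have "openin (subtopology T c) {x \<in> topspace T. x \<in> c \<and> x \<in> U}"
    if "openin (coherent_topology T C) U" for U
  proof -
    have "{x \<in> topspace T. x \<in> c \<and> x \<in> U} = U \<inter> c" using assms by auto
    then show ?thesis using that assms(2) by (simp add: openin_coherent_topology)
  qed
  then show ?thesis
    using assms by (auto simp: continuous_map_def topspace_coherent_topology)
qed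

text \<open>The tube lemma makes the product with a compact Hausdorff space coherent again.\<close>

lemma continuous_map_prod_coherent_topology:
  assumes T: "\<Union>C \<subseteq> topspace T"
    and Z: "compact_space Z" "Hausdorff_space Z"
    and cont: "\<And>c. c \<in> C \<Longrightarrow> continuous_map (prod_topology Z (subtopology T c)) Y f"
  shows "continuous_map (prod_topology Z (coherent_topology T C)) Y f"
  unfolding continuous_map_def topspace_prod_topology topspace_coherent_topology[OF T]
proof (intro conjI allI impI)
  show "f \<in> topspace Z \<times> \<Union>C \<rightarrow> topspace Y"
  proof
    fix w assume "w \<in> topspace Z \<times> \<Union>C"
    then obtain c where "c \<in> C" "w \<in> topspace Z \<times> c" by auto
    then have "w \<in> topspace (prod_topology Z (subtopology T c))" using T by auto
    then show "f w \<in> topspace Y" using cont[OF \<open>c \<in> C\<close>] by (auto simp: continuous_map_def)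
  qed
  fix O' assume O': "openin Y O'"
  define W where "W = {w \<in> topspace Z \<times> \<Union>C. f w \<in> O'}"
  have Wc: "openin (prod_topology Z (subtopology T c)) (W \<inter> (topspace Z \<times> c))" if c: "c \<in> C" for c
  proof -
    have "W \<inter> (topspace Z \<times> c) = {w \<in> topspace (prod_topology Z (subtopology T c)). f w \<in> O'}"
      using T c by (auto simp: W_def)
    then show ?thesis using cont[OF c] O' by (simp add: continuous_map_def)
  qed
  have "openin (prod_topology Z (coherent_topology T C)) W"
    unfolding openin_prod_topology_alt
  proof (intro allI impI)
    fix z x assume zx: "(z, x) \<in> W"
    then obtain c where c: "c \<in> C" "x \<in> c" by (auto simp: W_def)
    have x: "x \<in> topspace (subtopology T c)" using c T by auto
    have "continuous_map Z (prod_topology Z (subtopology T c)) (\<lambda>z. (z, x))"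
      using x by (auto simp: continuous_map_pairwise o_def)
    from openin_continuous_map_preimage[OF this Wc[OF c(1)]]
    have "openin Z {z \<in> topspace Z. (z, x) \<in> W \<inter> topspace Z \<times> c}" .
    \<comment> \<open>Regularity shrinks the open slice of \<open>W\<close> at \<open>x\<close> to a
      closed neighbourhood \<open>V\<close> of \<open>z\<close>; closedness is what the projection
      along \<open>Z\<close> needs.\<close>
    moreover have "neighbourhood_base_of (closedin Z) Z"
      using Z by (simp add: neighbourhood_base_of_closedin compact_Hausdorff_imp_regular_space)
    moreover have "z \<in> {z \<in> topspace Z. (z, x) \<in> W \<inter> topspace Z \<times> c}"
      using zx c by (auto simp: W_def)
    ultimately have "\<exists>V0 V. openin Z V0 \<and> closedin Z V \<and> z \<in> V0 \<and> V0 \<subseteq> V \<and>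
        V \<subseteq> {z \<in> topspace Z. (z, x) \<in> W \<inter> topspace Z \<times> c}"
      unfolding neighbourhood_base_of by (elim allE impE[OF _ conjI])
    then obtain V0 V where V: "openin Z V0" "closedin Z V" "z \<in> V0" "V0 \<subseteq> V"
      "V \<subseteq> {z \<in> topspace Z. (z, x) \<in> W \<inter> topspace Z \<times> c}"
      by blast
    \<comment> \<open>The largest set whose product with \<open>V\<close> lies in \<open>W\<close>.
      In each cell its complement is the projection of a closed set along the compact factor, hence
      closed.\<close>
    define U where "U = {y \<in> \<Union>C. \<forall>v\<in>V. (v, y) \<in> W}"
    have "openin (subtopology T d) (U \<inter> d)" if d: "d \<in> C" for d
    proof -
      have td: "topspace (subtopology T d) = d" using T d by auto
      have "closedin (prod_topology Z (subtopology T d)) ((V \<times> d) - W \<inter> (topspace Z \<times> d))"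
        using Wc[OF d] V(2) td by (intro closedin_diff) (auto simp: closedin_prod_Times_iff)
      moreover have "closed_map (prod_topology Z (subtopology T d)) (subtopology T d) snd"
        using Z(1) by (rule closed_map_snd)
      ultimately have "closedin (subtopology T d) (snd ` ((V \<times> d) - W \<inter> (topspace Z \<times> d)))"
        unfolding closed_map_def by blast
      moreover have "U \<inter> d = topspace (subtopology T d) - snd ` ((V \<times> d) - W \<inter> (topspace Z \<times> d))"
        unfolding td
      proof (intro set_eqI iffI)
        fix y assume "y \<in> d - snd ` (V \<times> d - W \<inter> topspace Z \<times> d)"
        then have "y \<in> d" and *: "\<And>v. v \<in> V \<Longrightarrow> (v, y) \<in> W" by force+
        then show "y \<in> U \<inter> d" using d by (auto simp: U_def)
      next
        fix y assume "y \<in> U \<inter> d"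
        then have "y \<in> d" and *: "\<And>v. v \<in> V \<Longrightarrow> (v, y) \<in> W" by (auto simp: U_def)
        then show "y \<in> d - snd ` (V \<times> d - W \<inter> topspace Z \<times> d)"
          using closedin_subset[OF V(2)] by auto
      qed
      ultimately show ?thesis by (metis openin_diff openin_topspace)
    qed
    then have "openin (coherent_topology T C) U" by (auto simp: openin_coherent_topology U_def)
    moreover have "x \<in> U" using c V(5) by (auto simp: U_def)
    moreover have "V0 \<times> U \<subseteq> W" using V(4) by (auto simp: U_def)
    ultimately show "\<exists>U V. openin Z U \<and> openin (coherent_topology T C) V \<and> z \<in> U \<and> x \<in> V \<and> U \<times> V \<subseteq> W"
      using V by blast
  qed
  then show "openin (prod_topology Z (coherent_topology T C)) {w \<in> topspace Z \<times> \<Union>C. f w \<in> O'}"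
    by (simp add: W_def)
qed

section \<open>Homotopies and transport of homotopy equivalences\<close>

lemma homotopic_withI:
  fixes h :: "real \<times> 'a \<Rightarrow> 'b"
  assumes "continuous_map (prod_topology (top_of_set {0..1}) X) Y h"
    and "\<And>x. x \<in> topspace X \<Longrightarrow> h (0, x) = f x" and "\<And>x. x \<in> topspace X \<Longrightarrow> h (1, x) = g x"
  shows "homotopic_with (\<lambda>_. True) X Y f g"
  using assms by (subst homotopic_with) (auto intro!: exI[of _ h])

text \<open>The inverse is \<open>\<Psi> \<circ> g\<close>: the homotopy on \<open>X'\<close> is
  conjugated by the homeomorphism, the one on \<open>Y\<close> is kept.\<close>

lemma homotopy_equivalence_map_compose_homeomorphic:
  assumes "homeomorphic_maps X X' \<Phi> \<Psi>" and f: "homotopy_equivalence_map X' Y f"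
    and eq: "\<And>x. x \<in> topspace X \<Longrightarrow> f' x = f (\<Phi> x)"
  shows "homotopy_equivalence_map X Y f'"
proof -
  have cont: "continuous_map X X' \<Phi>" "continuous_map X' X \<Psi>"
    and inv: "\<And>x. x \<in> topspace X \<Longrightarrow> \<Psi> (\<Phi> x) = x" "\<And>y. y \<in> topspace X' \<Longrightarrow> \<Phi> (\<Psi> y) = y"
    using assms(1) by (auto simp: homeomorphic_maps_def)
  from f obtain g where g: "continuous_map X' Y f" "continuous_map Y X' g"
      "homotopic_with (\<lambda>_. True) X' X' (g \<circ> f) id" "homotopic_with (\<lambda>_. True) Y Y (f \<circ> g) id"
    unfolding homotopy_equivalence_map_def by blast
  have f': "continuous_map X Y f'"
    using continuous_map_eq[OF continuous_map_compose[OF cont(1) g(1)]] eq by fastforce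
  have "homotopic_with (\<lambda>_. True) X X (\<Psi> \<circ> (g \<circ> f) \<circ> \<Phi>) (\<Psi> \<circ> id \<circ> \<Phi>)"
    by (rule homotopic_with_compose_continuous_map_right[OF
          homotopic_with_compose_continuous_map_left[OF g(3) cont(2)] cont(1)]) simp_all
  then have 1: "homotopic_with (\<lambda>_. True) X X ((\<Psi> \<circ> g) \<circ> f') id"
    by (rule homotopic_with_eq) (auto simp: eq inv)
  have "f' (\<Psi> (g y)) = f (g y)" if "y \<in> topspace Y" for y
  proof -
    have "g y \<in> topspace X'" using g(2) that by (auto simp: continuous_map_def)
    moreover then have "\<Psi> (g y) \<in> topspace X" using cont by (auto simp: continuous_map_def)
    ultimately show ?thesis by (simp add: eq inv)
  qed
  then have 2: "homotopic_with (\<lambda>_. True) Y Y (f' \<circ> (\<Psi> \<circ> g)) id"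
    by (intro homotopic_with_eq[OF g(4)]) auto
  show ?thesis
    unfolding homotopy_equivalence_map_def
    using f' 1 2 continuous_map_compose[OF g(2) cont(2)] by (intro conjI exI[of _ "\<Psi> \<circ> g"])
qed

section \<open>Realizations\<close>

abbreviation simplex_topology :: "'a set \<Rightarrow> ('a \<Rightarrow> real) topology" where
  "simplex_topology s \<equiv> subtopology (powertop_real UNIV) (closed_simplex s)"

text \<open>For infinite \<open>t\<close> the sum is 0 by convention and
  \<open>closed_simplex t\<close> is empty, so finiteness is what turns faces into subsets.\<close>

lemma closed_simplex_mono:
  assumes "s \<subseteq> t" "finite t"
  shows "closed_simplex s \<subseteq> closed_simplex t"
proof
  fix p assume p: "p \<in> closed_simplex s"
  have "sum p t = sum p s"
    using p assms by (intro sum.mono_neutral_right) (auto simp: closed_simplex_def)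
  then show "p \<in> closed_simplex t" using p assms by (auto simp: closed_simplex_def)
qed

text \<open>Constructions below sum over the support, so that they depend on the point alone; proofs
  rewrite them as sums over a fixed simplex, where continuity is visible.\<close>

lemma closed_simplex_sum_support:
  assumes "p \<in> closed_simplex s" and "finite s" and "\<And>v. p v = 0 \<Longrightarrow> f v = 0"
  shows "(\<Sum>v | p v \<noteq> 0. f v) = (\<Sum>v\<in>s. f v)"
  using assms by (intro sum.mono_neutral_left) (auto simp: closed_simplex_def)

lemma closed_simplex_support:
  assumes "p \<in> closed_simplex s" and "finite s"
  shows "{v. p v \<noteq> 0} \<subseteq> s" "{v. p v \<noteq> 0} \<noteq> {}" "p \<in> closed_simplex {v. p v \<noteq> 0}"
proof -
  show sub: "{v. p v \<noteq> 0} \<subseteq> s" using assms by (auto simp: closed_simplex_def)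
  have "(\<Sum>v | p v \<noteq> 0. p v) = 1"
    using closed_simplex_sum_support[OF assms, of p] assms by (simp add: closed_simplex_def)
  then show "{v. p v \<noteq> 0} \<noteq> {}" "p \<in> closed_simplex {v. p v \<noteq> 0}"
    using assms by (force, auto simp: closed_simplex_def)
qed

lemma compact_space_simplex_topology:
  assumes "finite s"
  shows "compact_space (simplex_topology s)"
proof -
  \<comment> \<open>A product of copies of [0,1] and {0}, compact by Tychonoff; the simplex is the
    closed subset where the coordinates in \<open>s\<close> sum to 1.\<close>
  let ?Q = "Pi\<^sub>E UNIV (\<lambda>v. if v \<in> s then {0..1} else {0::real})"
  have "compactin (powertop_real UNIV) ?Q"
    by (auto simp: compactin_PiE)
  moreover have "closedin (powertop_real UNIV) {p \<in> topspace (powertop_real UNIV). (\<Sum>v\<in>s. p v) \<in> {1::real}}"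
    by (rule closedin_continuous_map_preimage[where Y=euclideanreal])
      (auto intro!: continuous_intros simp: assms)
  ultimately have "compactin (powertop_real UNIV)
      ({p \<in> topspace (powertop_real UNIV). (\<Sum>v\<in>s. p v) \<in> {1::real}} \<inter> ?Q)"
    by (intro closed_Int_compactin)
  moreover have "{p \<in> topspace (powertop_real UNIV). (\<Sum>v\<in>s. p v) \<in> {1::real}} \<inter> ?Q = closed_simplex s"
  proof -
    have "p v \<le> 1" if "p \<in> closed_simplex s" for p :: "'a \<Rightarrow> real" and v
    proof (cases "v \<in> s")
      case True
      then have "p v \<le> sum p s"
        using that assms by (intro member_le_sum) (auto simp: closed_simplex_def)
      then show ?thesis using that by (simp add: closed_simplex_def)
    qed (use that in \<open>auto simp: closed_simplex_def\<close>)
    then show ?thesis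
      by (auto simp: closed_simplex_def PiE_UNIV_domain Pi_iff split: if_splits) (metis order_refl)
  qed
  ultimately show ?thesis by (simp add: compact_space_subtopology)
qed

lemma Hausdorff_space_simplex_topology: "Hausdorff_space (simplex_topology s)"
  by (simp add: Hausdorff_space_subtopology Hausdorff_space_product_topology)

lemma continuous_map_into_simplex_topology:
  "continuous_map Z (simplex_topology s) f \<longleftrightarrow>
     (\<forall>v. continuous_map Z euclideanreal (\<lambda>z. f z v)) \<and> (\<forall>z\<in>topspace Z. f z \<in> closed_simplex s)"
  by (auto simp: continuous_map_in_subtopology continuous_map_componentwise_UNIV)

lemma continuous_map_simplex_coordinate:
  assumes "continuous_map Z (simplex_topology s) f"
  shows "continuous_map Z euclideanreal (\<lambda>z. f z v)"
  using assms by (simp add: continuous_map_into_simplex_topology)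

lemma continuous_map_fst_real:
  "continuous_map (prod_topology (top_of_set (S :: real set)) Z) euclideanreal fst"
  using continuous_map_fst[of "top_of_set S" Z] by (simp add: continuous_map_in_subtopology)

lemma compact_Hausdorff_unit_interval:
  "compact_space (top_of_set {0..1::real})" "Hausdorff_space (top_of_set {0..1::real})"
  by (simp_all add: compact_space_subtopology Hausdorff_space_subtopology)

lemma realization_eq_coherent_topology:
  "realization K = coherent_topology (powertop_real UNIV) (closed_simplex ` K)"
  by (simp add: realization_def coherent_topology_def realization_points_def)

lemma continuous_map_realization:
  assumes "\<And>s. s \<in> K \<Longrightarrow> continuous_map (simplex_topology s) Y f"
  shows "continuous_map (realization K) Y f"
  using assms unfolding realization_eq_coherent_topology
  by (intro continuous_map_coherent_topology) auto

lemma continuous_map_prod_realization: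
  assumes "compact_space Z" "Hausdorff_space Z"
    and "\<And>s. s \<in> K \<Longrightarrow> continuous_map (prod_topology Z (simplex_topology s)) Y f"
  shows "continuous_map (prod_topology Z (realization K)) Y f"
  using assms unfolding realization_eq_coherent_topology
  by (intro continuous_map_prod_coherent_topology) auto

lemma continuous_map_simplex_inclusion:
  assumes "s \<in> K"
  shows "continuous_map (simplex_topology s) (realization K) (\<lambda>x. x)"
  using assms unfolding realization_eq_coherent_topology
  by (intro continuous_map_cell_inclusion) auto

lemma continuous_map_realization_mono:
  assumes "L \<subseteq> L'"
  shows "continuous_map (realization L) (realization L') (\<lambda>x. x)"
  using assms by (intro continuous_map_realization continuous_map_simplex_inclusion) auto

text \<open>The cell of \<open>J\<close> itself covers everything and induces the topologies of its
  faces, so the weak topology is the Euclidean one.\<close>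

lemma realization_full_simplex:
  assumes "finite J" "J \<noteq> {}"
  shows "realization (full_simplex J) = simplex_topology J"
proof -
  have J: "J \<in> full_simplex J" using assms by (simp add: full_simplex_def)
  have sub: "closed_simplex s \<subseteq> closed_simplex J" if "s \<in> full_simplex J" for s
    using that assms by (intro closed_simplex_mono) (auto simp: full_simplex_def)
  then have pts: "realization_points (full_simplex J) = closed_simplex J"
    using J by (auto simp: realization_points_def)
  have "openin (simplex_topology s) (U \<inter> closed_simplex s)"
    if "openin (simplex_topology J) U" "s \<in> full_simplex J" for U s
  proof -
    have "openin (subtopology (simplex_topology J) (closed_simplex s)) (U \<inter> closed_simplex s)"
      using that(1) by (rule openin_subtopology_Int)
    then show ?thesis using sub[OF that(2)] by (simp add: subtopology_subtopology Int_absorb1)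
  qed
  moreover have "U \<subseteq> closed_simplex J" if "openin (simplex_topology J) U" for U
    using openin_subset[OF that] by simp
  moreover have "openin (simplex_topology J) U"
    if "U \<subseteq> closed_simplex J" "\<forall>s\<in>full_simplex J. openin (simplex_topology s) (U \<inter> closed_simplex s)" for U
    using bspec[OF that(2) J] that(1) by (simp add: Int_absorb2)
  ultimately show ?thesis
    unfolding topology_eq openin_realization pts by blast
qed

text \<open>A simplex of \<open>K\<close> meets the realization of \<open>L\<close> in the union of
  those of its faces that lie in \<open>L\<close>. These are finitely many, so a set closed in the
  realization of \<open>L\<close> meets every simplex of \<open>K\<close> in a closed set.\<close>

lemma subtopology_realization_subcomplex:
  assumes K: "abstract_simplicial_complex K" and L: "subcomplex L K"
  shows "subtopology (realization K) (realization_points L) = realization L"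
proof -
  have fin: "finite s" if "s \<in> K" for s using K that by (auto simp: abstract_simplicial_complex_def)
  have LK: "L \<subseteq> K" and face: "\<And>s t. s \<in> L \<Longrightarrow> t \<noteq> {} \<Longrightarrow> t \<subseteq> s \<Longrightarrow> t \<in> L"
    using L unfolding subcomplex_def abstract_simplicial_complex_def by (blast, metis)
  have closedK: "closedin (realization K) D" if D: "closedin (realization L) D" for D
  proof -
    have DL: "D \<subseteq> realization_points L"
      and Dc: "\<And>s. s \<in> L \<Longrightarrow> closedin (simplex_topology s) (D \<inter> closed_simplex s)"
      using D by (auto simp: realization_eq_coherent_topology closedin_coherent_topology
          realization_points_def)
    have "closedin (simplex_topology s) (D \<inter> closed_simplex s)" if s: "s \<in> K" for s
    proof -
      have eq: "D \<inter> closed_simplex s = (\<Union>t\<in>{t\<in>L. t \<subseteq> s}. D \<inter> closed_simplex t)"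
      proof
        show "(\<Union>t\<in>{t\<in>L. t \<subseteq> s}. D \<inter> closed_simplex t) \<subseteq> D \<inter> closed_simplex s"
          using closed_simplex_mono[OF _ fin[OF s]] by auto
        show "D \<inter> closed_simplex s \<subseteq> (\<Union>t\<in>{t\<in>L. t \<subseteq> s}. D \<inter> closed_simplex t)"
        proof
          fix p assume p: "p \<in> D \<inter> closed_simplex s"
          then obtain t where t: "t \<in> L" "p \<in> closed_simplex t"
            using DL by (auto simp: realization_points_def)
          have ft: "finite t" using fin LK t(1) by blast
          have "{v. p v \<noteq> 0} \<in> L"
            by (rule face[OF t(1) closed_simplex_support(2,1)[OF t(2) ft]])
          moreover have "p \<in> closed_simplex s" "p \<in> D" using p by auto
          ultimately show "p \<in> (\<Union>t\<in>{t\<in>L. t \<subseteq> s}. D \<inter> closed_simplex t)"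
            using closed_simplex_support(1,3)[of p s] fin[OF s]
            by (intro UN_I[of "{v. p v \<noteq> 0}"]) auto
        qed
      qed
      have "closedin (simplex_topology s) (D \<inter> closed_simplex t)" if t: "t \<in> L" "t \<subseteq> s" for t
      proof -
        have st: "closed_simplex t \<subseteq> closed_simplex s" using t fin[OF s] by (intro closed_simplex_mono)
        then have top: "subtopology (simplex_topology s) (closed_simplex t) = simplex_topology t"
          by (simp add: subtopology_subtopology Int_absorb1)
        have "compactin (simplex_topology s) (closed_simplex t)"
          using compact_space_simplex_topology[of t] st t LK fin
          by (subst compactin_subspace) (auto simp: top)
        then have "closedin (simplex_topology s) (closed_simplex t)"
          by (rule compactin_imp_closedin[OF Hausdorff_space_simplex_topology])
        then show ?thesis
          using closedin_trans_full[of "simplex_topology s" "closed_simplex t"] Dc[OF t(1)] top by simp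
      qed
      moreover have "finite {t\<in>L. t \<subseteq> s}" using fin[OF s] by simp
      ultimately show ?thesis unfolding eq by (intro closedin_Union) auto
    qed
    moreover have "D \<subseteq> realization_points K"
      using DL LK by (auto simp: realization_points_def)
    ultimately show ?thesis
      by (auto simp: realization_eq_coherent_topology closedin_coherent_topology realization_points_def)
  qed
  have "topspace (subtopology (realization K) (realization_points L)) = topspace (realization L)"
    using LK by (auto simp: topspace_realization realization_points_def)
  moreover have "closedin (subtopology (realization K) (realization_points L)) D \<longleftrightarrow> closedin (realization L) D" for D
  proof
    assume "closedin (realization L) D"
    moreover then have "D \<subseteq> realization_points L"
      using closedin_subset topspace_realization by metis
    ultimately show "closedin (subtopology (realization K) (realization_points L)) D"
      using closedK closedin_subset_topspace by blast
  next
    assume "closedin (subtopology (realization K) (realization_points L)) D"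
    then obtain E where E: "closedin (realization K) E" "D = E \<inter> realization_points L"
      by (auto simp: closedin_subtopology)
    have "closedin (realization L) {x \<in> topspace (realization L). x \<in> E}"
      by (rule closedin_continuous_map_preimage[OF continuous_map_realization_mono[OF LK] E(1)])
    then show "closedin (realization L) D"
      using E(2) by (simp add: topspace_realization Int_def conj_commute)
  qed
  ultimately show ?thesis by (simp add: topology_eq openin_closedin_eq)
qed

text \<open>The segment from a point over \<open>J\<close> to the vertex \<open>i\<close> stays in
  the simplex on \<open>insert i J\<close>, so the straight-line contraction is continuous simplex
  by simplex, even for infinite \<open>S\<close>.\<close>

lemma contractible_full_complex:
  assumes "i \<in> S"
  shows "contractible_space (realization {J. finite J \<and> J \<noteq> {} \<and> J \<subseteq> S})"
proof -
  define N where "N = {J. finite J \<and> J \<noteq> {} \<and> J \<subseteq> S}"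
  define d :: "'a \<Rightarrow> real" where "d = (\<lambda>v. if v = i then 1 else 0)"
  define h where "h = (\<lambda>(t::real, p :: 'a \<Rightarrow> real). \<lambda>v. (1 - t) * p v + t * d v)"
  have "continuous_map (prod_topology (top_of_set {0..1}) (realization N)) (realization N) h"
  proof (intro continuous_map_prod_realization compact_Hausdorff_unit_interval)
    fix J assume J: "J \<in> N"
    then have iJ: "insert i J \<in> N" using assms by (auto simp: N_def)
    have "h (t, p) \<in> closed_simplex (insert i J)" if t: "t \<in> {0..1}" and p: "p \<in> closed_simplex J" for t p
    proof -
      have fin: "finite (insert i J)" using J by (simp add: N_def)
      have "p \<in> closed_simplex (insert i J)" "d \<in> closed_simplex (insert i J)"
        using p closed_simplex_mono[OF _ fin] fin by (blast, auto simp: closed_simplex_def d_def)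
      then show ?thesis
        using t by (auto simp: h_def closed_simplex_def sum.distrib simp flip: sum_distrib_left)
    qed
    moreover have "continuous_map (prod_topology (top_of_set {0..1}) (simplex_topology J))
        euclideanreal (\<lambda>z. h z v)" for v
      unfolding h_def case_prod_unfold
      by (intro continuous_intros continuous_map_fst_real
          continuous_map_simplex_coordinate[OF continuous_map_snd]) auto
    ultimately have "continuous_map (prod_topology (top_of_set {0..1}) (simplex_topology J))
        (simplex_topology (insert i J)) h"
      by (auto simp: continuous_map_into_simplex_topology)
    from continuous_map_compose[OF this continuous_map_simplex_inclusion[OF iJ]]
    show "continuous_map (prod_topology (top_of_set {0..1}) (simplex_topology J)) (realization N) h"
      by (simp add: o_def)
  qed
  then have "homotopic_with (\<lambda>_. True) (realization N) (realization N) id (\<lambda>_. d)"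
    by (rule homotopic_withI) (auto simp: h_def)
  then show ?thesis unfolding contractible_space_def N_def by blast
qed

section \<open>Unions of products of simplices\<close>

lemma abstract_simplicial_complexD:
  assumes "abstract_simplicial_complex K" "s \<in> K"
  shows "finite s" "s \<noteq> {}" "t \<subseteq> s \<Longrightarrow> t \<noteq> {} \<Longrightarrow> t \<in> K"
  using assms unfolding abstract_simplicial_complex_def by metis+

lemma abstract_simplicial_complex_INT:
  assumes "J \<noteq> {}" and "\<And>i. i \<in> J \<Longrightarrow> abstract_simplicial_complex (A i)"
  shows "abstract_simplicial_complex (\<Inter>i\<in>J. A i)"
proof -
  obtain j where "j \<in> J" using assms(1) by blast
  then have "finite s \<and> s \<noteq> {}" if "s \<in> (\<Inter>i\<in>J. A i)" for s
    using that assms(2) abstract_simplicial_complexD(1,2) by (metis INT_D)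
  moreover have "t \<in> (\<Inter>i\<in>J. A i)" if "s \<in> (\<Inter>i\<in>J. A i)" "t \<noteq> {}" "t \<subseteq> s" for s t
    using abstract_simplicial_complexD(3)[OF assms(2)] that by (intro INT_I) (metis INT_D)
  ultimately show ?thesis unfolding abstract_simplicial_complex_def by blast
qed

lemma sum_topology_cong:
  assumes "\<And>i. i \<in> I \<Longrightarrow> X i = Y i"
  shows "sum_topology X I = sum_topology Y I"
proof -
  have "Sigma I (topspace \<circ> X) = Sigma I (topspace \<circ> Y)" using assms by auto
  then show ?thesis using assms by (simp add: topology_eq openin_sum_topology)
qed

lemma continuous_map_from_sum_topology:
  assumes "\<And>i. i \<in> I \<Longrightarrow> continuous_map (X i) Y (\<lambda>x. f (i, x))"
  shows "continuous_map (sum_topology X I) Y f"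
  unfolding continuous_map_def
proof (intro conjI allI impI)
  show "f \<in> topspace (sum_topology X I) \<rightarrow> topspace Y"
    using assms by (fastforce simp: continuous_map_def Pi_iff)
  fix U assume U: "openin Y U"
  have "openin (X i) {x. (i, x) \<in> {z \<in> topspace (sum_topology X I). f z \<in> U}}" if "i \<in> I" for i
    using openin_continuous_map_preimage[OF assms[OF that] U] that by simp
  then show "openin (sum_topology X I) {z \<in> topspace (sum_topology X I). f z \<in> U}"
    by (auto simp: openin_sum_topology)
qed

text \<open>The support is the smallest simplex carrying \<open>p\<close> and does not depend on
  \<open>L\<close>; hence taking realization points commutes with intersections of
  complexes.\<close>

lemma realization_points_iff_support:
  assumes "abstract_simplicial_complex L"
  shows "p \<in> realization_points L \<longleftrightarrow> {v. p v \<noteq> 0} \<in> L \<and> p \<in> closed_simplex {v. p v \<noteq> 0}"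
proof
  assume "p \<in> realization_points L"
  then obtain s where s: "s \<in> L" "p \<in> closed_simplex s" by (auto simp: realization_points_def)
  note supp = closed_simplex_support[OF s(2) abstract_simplicial_complexD(1)[OF assms s(1)]]
  show "{v. p v \<noteq> 0} \<in> L \<and> p \<in> closed_simplex {v. p v \<noteq> 0}"
    using abstract_simplicial_complexD(3)[OF assms s(1) supp(1,2)] supp(3) by (rule conjI)
next
  assume "{v. p v \<noteq> 0} \<in> L \<and> p \<in> closed_simplex {v. p v \<noteq> 0}"
  then show "p \<in> realization_points L" unfolding realization_points_def by blast
qed

lemma realization_points_nonempty:
  assumes "abstract_simplicial_complex L" "L \<noteq> {}"
  shows "realization_points L \<noteq> {}"
proof -
  obtain s where s: "s \<in> L" using assms(2) by blast
  obtain v where "v \<in> s" using abstract_simplicial_complexD(2)[OF assms(1) s] by blast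
  then have "(\<lambda>w. if w = v then 1 else 0) \<in> closed_simplex s"
    using abstract_simplicial_complexD(1)[OF assms(1) s] by (auto simp: closed_simplex_def)
  then show ?thesis using s by (auto simp: realization_points_def)
qed

text \<open>Each cell carries the product topology and the union carries the weak one, not the
  topology of a product of two realizations.\<close>

definition product_complex :: "('a set \<times> 'i set) set \<Rightarrow> (('a \<Rightarrow> real) \<times> ('i \<Rightarrow> real)) topology" where
  "product_complex R = coherent_topology (prod_topology (powertop_real UNIV) (powertop_real UNIV))
     ((\<lambda>(s, t). closed_simplex s \<times> closed_simplex t) ` R)"

lemma topspace_product_complex:
  "topspace (product_complex R) = (\<Union>(s, t)\<in>R. closed_simplex s \<times> closed_simplex t)"
  unfolding product_complex_def by (subst topspace_coherent_topology) auto

lemma continuous_map_prod_product_complex: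
  assumes "compact_space Z" "Hausdorff_space Z"
    and "\<And>s t. (s, t) \<in> R \<Longrightarrow>
      continuous_map (prod_topology Z (prod_topology (simplex_topology s) (simplex_topology t))) Y f"
  shows "continuous_map (prod_topology Z (product_complex R)) Y f"
  using assms unfolding product_complex_def
  by (intro continuous_map_prod_coherent_topology) (auto simp: subtopology_Times)

lemma continuous_map_product_complex:
  assumes "\<And>s t. (s, t) \<in> R \<Longrightarrow>
      continuous_map (prod_topology (simplex_topology s) (simplex_topology t)) Y f"
  shows "continuous_map (product_complex R) Y f"
  using assms unfolding product_complex_def
  by (intro continuous_map_coherent_topology) (auto simp: subtopology_Times)

lemma continuous_map_cell_product_complex:
  assumes "(s, t) \<in> R"
  shows "continuous_map (prod_topology (simplex_topology s) (simplex_topology t))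
    (product_complex R) (\<lambda>x. x)"
  using assms unfolding product_complex_def subtopology_Times[symmetric]
  by (intro continuous_map_cell_inclusion) (auto intro!: rev_image_eqI[of "(s, t)"])

text \<open>Compactness of the simplex on \<open>s\<close> lets the weak topology of the fibre be
  tested one simplex at a time, and there the map is the inclusion of a cell.\<close>

lemma continuous_map_simplex_times_fibre:
  assumes "finite s"
  shows "continuous_map (prod_topology (simplex_topology s) (realization (R `` {s})))
    (product_complex R) (\<lambda>x. x)"
  by (intro continuous_map_prod_realization continuous_map_cell_product_complex
      compact_space_simplex_topology assms Hausdorff_space_simplex_topology) auto

lemma continuous_map_prod_swap: "continuous_map (prod_topology X Y) (prod_topology Y X) prod.swap"
  by (auto simp: continuous_map_pairwise o_def continuous_map_fst continuous_map_snd)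

lemma continuous_map_swap_product_complex:
  "continuous_map (product_complex R) (product_complex (R\<inverse>)) prod.swap"
proof (rule continuous_map_product_complex)
  fix s t assume "(s, t) \<in> R"
  then have "continuous_map (prod_topology (simplex_topology t) (simplex_topology s))
      (product_complex (R\<inverse>)) (\<lambda>x. x)"
    by (intro continuous_map_cell_product_complex) simp
  from continuous_map_compose[OF continuous_map_prod_swap this]
  show "continuous_map (prod_topology (simplex_topology s) (simplex_topology t))
      (product_complex (R\<inverse>)) prod.swap"
    by (simp add: o_def)
qed

lemma homeomorphic_maps_swap_product_complex:
  "homeomorphic_maps (product_complex R) (product_complex (R\<inverse>)) prod.swap prod.swap"
  using continuous_map_swap_product_complex[of R] continuous_map_swap_product_complex[of "R\<inverse>"]
  by (simp add: homeomorphic_maps_def)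

lemma continuous_map_fibre_times_simplex:
  assumes "finite t"
  shows "continuous_map (prod_topology (realization (R\<inverse> `` {t})) (simplex_topology t))
    (product_complex R) (\<lambda>x. x)"
proof -
  have "continuous_map (prod_topology (realization (R\<inverse> `` {t})) (simplex_topology t))
      (product_complex R) (prod.swap \<circ> ((\<lambda>x. x) \<circ> prod.swap))"
    using continuous_map_swap_product_complex[of "R\<inverse>"]
      continuous_map_simplex_times_fibre[OF assms, of "R\<inverse>"]
    by (intro continuous_map_compose[OF continuous_map_compose[OF continuous_map_prod_swap]]) simp_all
  then show ?thesis by (simp add: o_def)
qed

section \<open>Thresholds and superlevel sets\<close>

text \<open>The level \<open>\<theta>\<close>: a polynomial in the coordinates on every simplex,
  hence continuous there; summing over the support frees it from the choice of a simplex.\<close>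

definition threshold :: "('a \<Rightarrow> real) \<Rightarrow> real" where
  "threshold x = (\<Sum>v | x v \<noteq> 0. (x v)\<^sup>2) / 2"

text \<open>As the coordinates sum to \<open>1\<close>, the threshold is at most half the largest coordinate. Shrinking
  keeps the coordinates above the threshold, while the nested superlevel sets below the threshold
  select the contractions to be applied in the fibre.\<close>

definition shrink :: "('a \<Rightarrow> real) \<Rightarrow> 'a \<Rightarrow> real" where
  "shrink x = (\<lambda>v. max 0 (x v - threshold x) / (\<Sum>w | x w \<noteq> 0. max 0 (x w - threshold x)))"

lemma threshold_eq:
  assumes "x \<in> closed_simplex s" "finite s"
  shows "threshold x = (\<Sum>v\<in>s. (x v)\<^sup>2) / 2"
  unfolding threshold_def using closed_simplex_sum_support[OF assms, of "\<lambda>v. (x v)\<^sup>2"] by simp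

lemma threshold_pos:
  assumes "x \<in> closed_simplex s" "finite s"
  shows "0 < threshold x"
proof -
  have "finite {v. x v \<noteq> 0}" "{v. x v \<noteq> 0} \<noteq> {}"
    using closed_simplex_support[OF assms] assms(2) finite_subset by (blast, blast)
  then have "0 < (\<Sum>v | x v \<noteq> 0. (x v)\<^sup>2)" by (intro sum_pos) auto
  then show ?thesis by (simp add: threshold_def)
qed

text \<open>Otherwise the sum of squares, which is twice the threshold, would be at most the
  threshold times the sum of the coordinates, that is, the threshold itself, although this is
  positive.\<close>

lemma exceeds_threshold:
  assumes x: "x \<in> closed_simplex s" "finite s"
  shows "\<exists>v\<in>s. threshold x < x v"
proof (rule ccontr)
  assume "\<not> ?thesis"
  then have "(x v)\<^sup>2 \<le> x v * threshold x" if "v \<in> s" for v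
    using that x unfolding power2_eq_square
    by (intro mult_left_mono) (auto simp: closed_simplex_def not_less)
  then have "2 * threshold x \<le> (\<Sum>v\<in>s. x v * threshold x)"
    unfolding threshold_eq[OF x] by (simp add: sum_mono)
  also have "\<dots> = threshold x"
    using x by (simp add: closed_simplex_def flip: sum_distrib_right)
  finally show False using threshold_pos[OF x] by simp
qed

lemma shrink_eq:
  assumes x: "x \<in> closed_simplex s" "finite s"
  shows "shrink x = (\<lambda>v. max 0 (x v - threshold x) / (\<Sum>w\<in>s. max 0 (x w - threshold x)))"
  unfolding shrink_def
  using closed_simplex_sum_support[OF x, of "\<lambda>w. max 0 (x w - threshold x)"] threshold_pos[OF x]
  by simp

lemma shrink_denominator_pos:
  assumes x: "x \<in> closed_simplex s" "finite s"
  shows "0 < (\<Sum>w\<in>s. max 0 (x w - threshold x))"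
proof -
  obtain v where "v \<in> s" "threshold x < x v" using exceeds_threshold[OF x] by blast
  then show ?thesis using x(2) by (intro sum_pos2[of s v]) auto
qed

text \<open>Coordinates at or below the threshold become 0, so any face containing all vertices
  above it carries the shrunk point.\<close>

lemma shrink_in_closed_simplex:
  assumes x: "x \<in> closed_simplex s" "finite s" and "\<sigma> \<subseteq> s"
    and le: "\<And>v. v \<in> s - \<sigma> \<Longrightarrow> x v \<le> threshold x"
  shows "shrink x \<in> closed_simplex \<sigma>"
proof -
  let ?D = "\<Sum>w\<in>s. max 0 (x w - threshold x)"
  have "x v \<le> threshold x" if "v \<notin> \<sigma>" for v
    using that x le threshold_pos[OF x] by (cases "v \<in> s") (auto simp: closed_simplex_def)
  moreover have "?D = (\<Sum>w\<in>\<sigma>. max 0 (x w - threshold x))"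
    using le assms(2,3) by (intro sum.mono_neutral_right) auto
  ultimately show ?thesis
    using shrink_denominator_pos[OF x]
    unfolding shrink_eq[OF x] closed_simplex_def by (auto simp flip: sum_divide_distrib)
qed

lemma continuous_map_threshold:
  assumes "finite s"
  shows "continuous_map (simplex_topology s) euclideanreal threshold"
proof (rule continuous_map_eq)
  show "continuous_map (simplex_topology s) euclideanreal (\<lambda>x. (\<Sum>v\<in>s. (x v)\<^sup>2) / 2)"
    using assms by (intro continuous_intros continuous_map_simplex_coordinate[OF continuous_map_id[unfolded id_def]]) auto
qed (use assms in \<open>simp add: threshold_eq\<close>)

lemma continuous_map_shrink:
  assumes "finite s"
  shows "continuous_map (simplex_topology s) (simplex_topology s) shrink"
  unfolding continuous_map_into_simplex_topology
proof (intro conjI allI ballI)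
  fix v
  show "continuous_map (simplex_topology s) euclideanreal (\<lambda>x. shrink x v)"
  proof (rule continuous_map_eq)
    show "continuous_map (simplex_topology s) euclideanreal
        (\<lambda>x. max 0 (x v - threshold x) / (\<Sum>w\<in>s. max 0 (x w - threshold x)))"
      using assms shrink_denominator_pos
      by (intro continuous_intros continuous_map_threshold
          continuous_map_simplex_coordinate[OF continuous_map_id[unfolded id_def]]) fastforce+
  qed (use assms in \<open>simp add: shrink_eq\<close>)
qed (use assms shrink_in_closed_simplex in fastforce)

definition shrink_homotopy :: "real \<times> ('a \<Rightarrow> real) \<Rightarrow> 'a \<Rightarrow> real" where
  "shrink_homotopy = (\<lambda>(t, x) v. (1 - t) * x v + t * shrink x v)"

lemma continuous_map_shrink_homotopy:
  assumes "finite s"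
  shows "continuous_map (prod_topology (top_of_set {0..1}) (simplex_topology s)) (simplex_topology s)
    shrink_homotopy"
  unfolding continuous_map_into_simplex_topology
proof (intro conjI allI ballI)
  fix v
  show "continuous_map (prod_topology (top_of_set {0..1::real}) (simplex_topology s)) euclideanreal
      (\<lambda>z. shrink_homotopy z v)"
    unfolding shrink_homotopy_def case_prod_unfold
    using continuous_map_compose[OF continuous_map_snd continuous_map_shrink[OF assms]]
    by (intro continuous_intros continuous_map_fst_real
        continuous_map_simplex_coordinate[OF continuous_map_snd]
        continuous_map_simplex_coordinate[of _ s "\<lambda>z. shrink (snd z)"]) (auto simp: o_def)
next
  fix z :: "real \<times> ('a \<Rightarrow> real)"
  assume "z \<in> topspace (prod_topology (top_of_set {0..1}) (simplex_topology s))"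
  then obtain t x where z: "z = (t, x)" "t \<in> {0..1}" "x \<in> closed_simplex s" by auto
  moreover have "shrink x \<in> closed_simplex s"
    using z assms by (intro shrink_in_closed_simplex) auto
  ultimately show "shrink_homotopy z \<in> closed_simplex s"
    by (auto simp: shrink_homotopy_def closed_simplex_def sum.distrib simp flip: sum_distrib_left)
qed

text \<open>If positive, this is the length of the interval of levels below the threshold whose superlevel set
  is \<open>\<sigma>\<close>; there is at most one such \<open>\<sigma>\<close> of each cardinality.\<close>

definition gap :: "('a \<Rightarrow> real) \<Rightarrow> 'a set \<Rightarrow> real" where
  "gap x \<sigma> = Min ((\<lambda>v. min (x v) (threshold x)) ` \<sigma>) -
     Max (insert 0 ((\<lambda>v. min (x v) (threshold x)) ` ({v. x v \<noteq> 0} - \<sigma>)))"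

lemma gap_le:
  assumes x: "x \<in> closed_simplex s" "finite s" and "finite \<sigma>" "u \<in> \<sigma>"
  shows "gap x \<sigma> \<le> min (x u) (threshold x)"
    and "w \<notin> \<sigma> \<Longrightarrow> gap x \<sigma> \<le> min (x u) (threshold x) - min (x w) (threshold x)"
proof -
  let ?y = "\<lambda>v. min (x v) (threshold x)" and ?S = "{v. x v \<noteq> 0}"
  have fin: "finite ?S" using closed_simplex_support(1)[OF x] x(2) by (rule finite_subset)
  have 1: "Min (?y ` \<sigma>) \<le> ?y u" using assms by (intro Min_le) auto
  have 2: "0 \<le> Max (insert 0 (?y ` (?S - \<sigma>)))" using fin by (intro Max_ge) auto
  show "gap x \<sigma> \<le> ?y u" using 1 2 by (simp add: gap_def)
  assume w: "w \<notin> \<sigma>"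
  \<comment> \<open>A vertex outside the support does not occur in the image, but its clipped value
    is at most the inserted 0.\<close>
  have "?y w \<le> Max (insert 0 (?y ` (?S - \<sigma>)))"
  proof (cases "x w = 0")
    case True
    then show ?thesis using 2 by simp
  next
    case False
    then show ?thesis using w fin by (intro Max_ge) auto
  qed
  then show "gap x \<sigma> \<le> ?y u - ?y w" using 1 unfolding gap_def by linarith
qed

text \<open>Each of two distinct sets of equal size has an element outside the other, and comparing
  these elements bounds the two gaps by opposite numbers. The bound on \<open>gap x \<tau>\<close>
  is weak so that a candidate with vanishing gap can be compared as well.\<close>

lemma gap_unique:
  assumes x: "x \<in> closed_simplex s" "finite s" and fin: "finite \<sigma>" "finite \<tau>"
    and "card \<sigma> = card \<tau>" and "0 < gap x \<sigma>" "0 \<le> gap x \<tau>"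
  shows "\<sigma> = \<tau>"
proof (rule ccontr)
  assume "\<sigma> \<noteq> \<tau>"
  then have "\<not> \<sigma> \<subseteq> \<tau>" "\<not> \<tau> \<subseteq> \<sigma>"
    using card_subset_eq[OF fin(1)] card_subset_eq[OF fin(2)] assms(5) by metis+
  then obtain u w where "u \<in> \<sigma>" "u \<notin> \<tau>" "w \<in> \<tau>" "w \<notin> \<sigma>" by blast
  then have "gap x \<sigma> \<le> min (x u) (threshold x) - min (x w) (threshold x)"
    "gap x \<tau> \<le> min (x w) (threshold x) - min (x u) (threshold x)"
    using gap_le(2)[OF x] fin by blast+
  then show False using assms by linarith
qed

lemma gap_pos_subset_support:
  assumes x: "x \<in> closed_simplex s" "finite s" and "finite \<sigma>" "0 < gap x \<sigma>"
  shows "\<sigma> \<subseteq> {v. x v \<noteq> 0}"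
  using gap_le(1)[OF x assms(3)] assms(4) by fastforce

text \<open>On the piece of \<open>(\<sigma>, \<beta>)\<close> the only candidates for superlevel sets below the threshold are the
  unions of \<open>\<sigma>\<close> with an initial segment of \<open>\<beta>\<close>.\<close>

definition splittings :: "'a set \<Rightarrow> ('a set \<times> 'a list) set" where
  "splittings s = {(\<sigma>, \<beta>). \<sigma> \<noteq> {} \<and> distinct \<beta> \<and> \<sigma> \<inter> set \<beta> = {} \<and> \<sigma> \<union> set \<beta> = s}"

text \<open>All inequalities are weak, so pieces are closed and overlap: a vertex exactly at the
  threshold may belong to either part, and ties in \<open>\<beta>\<close> may be ordered either
  way.\<close>

definition piece :: "'a set \<Rightarrow> 'a list \<Rightarrow> ('a \<Rightarrow> real) set" where
  "piece \<sigma> \<beta> = {x \<in> closed_simplex (\<sigma> \<union> set \<beta>). (\<forall>v\<in>\<sigma>. threshold x \<le> x v) \<and>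
     (\<forall>v\<in>set \<beta>. x v \<le> threshold x) \<and> sorted_wrt (\<lambda>u v. x v \<le> x u) \<beta>}"

lemma finite_splittings:
  assumes "finite s"
  shows "finite (splittings s)"
proof (rule finite_subset)
  show "splittings s \<subseteq> Pow s \<times> {\<beta>. set \<beta> \<subseteq> s \<and> length \<beta> \<le> card s}"
    using assms by (auto simp: splittings_def intro!: card_mono simp flip: distinct_card)
qed (use assms finite_lists_length_le in auto)

lemma splittings_pieces_cover:
  assumes x: "x \<in> closed_simplex s" "finite s"
  shows "\<exists>(\<sigma>, \<beta>)\<in>splittings s. x \<in> piece \<sigma> \<beta>"
proof -
  let ?\<sigma> = "{v\<in>s. threshold x \<le> x v}"
  obtain l where l: "set l = s - ?\<sigma>" "distinct l"
    using finite_distinct_list[of "s - ?\<sigma>"] x(2) by auto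
  let ?\<beta> = "sort_key (\<lambda>v. - x v) l"
  have "sorted_wrt (\<lambda>u v. x v \<le> x u) ?\<beta>"
    using sorted_sort_key[of "\<lambda>v. - x v" l] by (simp add: sorted_map)
  moreover have "?\<sigma> \<union> set ?\<beta> = s" "?\<sigma> \<inter> set ?\<beta> = {}" "distinct ?\<beta>" using l by auto
  moreover have "?\<sigma> \<noteq> {}" using exceeds_threshold[OF x] by fastforce
  ultimately have "(?\<sigma>, ?\<beta>) \<in> splittings s \<and> x \<in> piece ?\<sigma> ?\<beta>"
    using x l by (auto simp: splittings_def piece_def)
  then show ?thesis by blast
qed

lemma closedin_Collect_ball_le:
  assumes "\<And>i. i \<in> F \<Longrightarrow> continuous_map X euclideanreal (f i)"
    and "\<And>i. i \<in> F \<Longrightarrow> continuous_map X euclideanreal (g i)"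
  shows "closedin X {x \<in> topspace X. \<forall>i\<in>F. f i x \<le> g i x}"
proof (cases "F = {}")
  case False
  have "closedin X {x \<in> topspace X. g i x - f i x \<in> {0..}}" if "i \<in> F" for i
    using assms[OF that] closed_atLeast[of "0::real"]
    by (intro closedin_continuous_map_preimage[where Y=euclideanreal] continuous_intros) auto
  then have "closedin X (\<Inter>i\<in>F. {x \<in> topspace X. g i x - f i x \<in> {0..}})"
    using False by (intro closedin_INT)
  also have "(\<Inter>i\<in>F. {x \<in> topspace X. g i x - f i x \<in> {0..}}) = {x \<in> topspace X. \<forall>i\<in>F. f i x \<le> g i x}"
    using False by auto
  finally show ?thesis .
qed simp

lemma closedin_piece:
  assumes s: "finite s" "(\<sigma>, \<beta>) \<in> splittings s"
  shows "closedin (simplex_topology s) (piece \<sigma> \<beta>)"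
proof -
  let ?X = "simplex_topology s"
  have eq: "\<sigma> \<union> set \<beta> = s" using s by (simp add: splittings_def)
  note cont = continuous_map_threshold[OF s(1)]
    continuous_map_simplex_coordinate[OF continuous_map_id[unfolded id_def]]
  have "closedin ?X {x \<in> topspace ?X. \<forall>v\<in>\<sigma>. threshold x \<le> x v}"
    "closedin ?X {x \<in> topspace ?X. \<forall>v\<in>set \<beta>. x v \<le> threshold x}"
    "closedin ?X {x \<in> topspace ?X. \<forall>p\<in>{(i, j). i < j \<and> j < length \<beta>}. x (\<beta> ! snd p) \<le> x (\<beta> ! fst p)}"
    by (intro closedin_Collect_ball_le cont)+
  then have "closedin ?X ({x \<in> topspace ?X. \<forall>v\<in>\<sigma>. threshold x \<le> x v} \<inter>
    {x \<in> topspace ?X. \<forall>v\<in>set \<beta>. x v \<le> threshold x} \<inter>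
    {x \<in> topspace ?X. \<forall>p\<in>{(i, j). i < j \<and> j < length \<beta>}. x (\<beta> ! snd p) \<le> x (\<beta> ! fst p)})"
    by (intro closedin_Int)
  also have "\<dots> = piece \<sigma> \<beta>"
    unfolding piece_def eq by (auto simp: sorted_wrt_iff_nth_less)
  finally show ?thesis .
qed

text \<open>Pasting along finitely many closed sets. It allows continuity to be shown with a formula
  that changes with the order of the coordinates.\<close>

lemma continuous_map_from_pieces:
  assumes "finite s"
    and cont: "\<And>\<sigma> \<beta>. (\<sigma>, \<beta>) \<in> splittings s \<Longrightarrow> continuous_map
      (prod_topology T (prod_topology (subtopology (powertop_real UNIV) (piece \<sigma> \<beta>)) Z)) Y f"
  shows "continuous_map (prod_topology T (prod_topology (simplex_topology s) Z)) Y f"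
proof (rule pasting_lemma_closed[where f="\<lambda>_. f" and I="splittings s" and
      T="\<lambda>(\<sigma>, \<beta>). topspace T \<times> (piece \<sigma> \<beta> \<times> topspace Z)"])
  show "finite (splittings s)" using assms(1) by (rule finite_splittings)
next
  fix p assume p: "p \<in> splittings s"
  obtain \<sigma> \<beta> where [simp]: "p = (\<sigma>, \<beta>)" by fastforce
  have cl: "closedin (simplex_topology s) (piece \<sigma> \<beta>)"
    using closedin_piece[OF assms(1)] p by simp
  then show "closedin (prod_topology T (prod_topology (simplex_topology s) Z))
      (case p of (\<sigma>, \<beta>) \<Rightarrow> topspace T \<times> (piece \<sigma> \<beta> \<times> topspace Z))"
    by (simp add: closedin_prod_Times_iff)
  have "piece \<sigma> \<beta> \<subseteq> closed_simplex s" using closedin_subset[OF cl] by simp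
  then have "subtopology (prod_topology T (prod_topology (simplex_topology s) Z))
      (topspace T \<times> (piece \<sigma> \<beta> \<times> topspace Z)) =
    prod_topology T (prod_topology (subtopology (powertop_real UNIV) (piece \<sigma> \<beta>)) Z)"
    by (simp add: subtopology_Times subtopology_subtopology Int_absorb1)
  then show "continuous_map (subtopology (prod_topology T (prod_topology (simplex_topology s) Z))
      (case p of (\<sigma>, \<beta>) \<Rightarrow> topspace T \<times> (piece \<sigma> \<beta> \<times> topspace Z))) Y f"
    using cont p by simp
next
  fix z assume z: "z \<in> topspace (prod_topology T (prod_topology (simplex_topology s) Z))"
  then obtain \<sigma> \<beta> where "(\<sigma>, \<beta>) \<in> splittings s" "fst (snd z) \<in> piece \<sigma> \<beta>"
    using splittings_pieces_cover[OF _ assms(1), of "fst (snd z)"] by auto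
  then show "\<exists>p. p \<in> splittings s \<and> z \<in> (case p of (\<sigma>, \<beta>) \<Rightarrow> topspace T \<times> (piece \<sigma> \<beta> \<times> topspace Z)) \<and>
      f z = f z"
    using z by (intro exI[of _ "(\<sigma>, \<beta>)"]) (auto simp: mem_Times_iff)
qed simp

text \<open>The breakpoints of the superlevel sets in descending order. Entry \<open>i\<close> is
  the coordinate at position \<open>i - 1\<close> of \<open>\<beta>\<close>; the threshold is put in
  front and 0 at the end, so that the differences sum to the threshold.\<close>

definition level :: "'a list \<Rightarrow> ('a \<Rightarrow> real) \<Rightarrow> nat \<Rightarrow> real" where
  "level \<beta> x i = (if i = 0 then threshold x else if i \<le> length \<beta> then x (\<beta> ! (i - 1)) else 0)"

lemma level_Suc_le:
  assumes "finite s" "(\<sigma>, \<beta>) \<in> splittings s" "x \<in> piece \<sigma> \<beta>" "i \<le> length \<beta>"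
  shows "level \<beta> x (Suc i) \<le> level \<beta> x i"
proof -
  have x: "x \<in> closed_simplex s" using assms by (simp add: splittings_def piece_def)
  have "\<forall>v\<in>set \<beta>. x v \<le> threshold x" and srt: "sorted_wrt (\<lambda>u v. x v \<le> x u) \<beta>"
    using assms by (auto simp: piece_def)
  moreover then have "Suc 0 \<le> length \<beta> \<longrightarrow> x (\<beta> ! 0) \<le> threshold x"
    by (metis Suc_le_eq nth_mem)
  moreover have "x (\<beta> ! i) \<le> x (\<beta> ! (i - 1))" if "0 < i" "i < length \<beta>"
    using sorted_wrt_nth_less[OF srt, of "i - 1" i] that by simp
  ultimately show ?thesis
    using threshold_pos[OF x assms(1)] x assms(4) by (auto simp: level_def closed_simplex_def)
qed

text \<open>By sortedness the smallest clipped value inside is level \<open>i\<close> and the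
  largest outside is level \<open>Suc i\<close>. On a piece this replaces \<open>Min\<close> and
  \<open>Max\<close> by a difference of continuous functions.\<close>

lemma gap_piece:
  assumes s: "finite s" "(\<sigma>, \<beta>) \<in> splittings s" and x: "x \<in> piece \<sigma> \<beta>" and i: "i \<le> length \<beta>"
  shows "gap x (\<sigma> \<union> set (take i \<beta>)) = level \<beta> x i - level \<beta> x (Suc i)"
proof -
  let ?y = "\<lambda>v. min (x v) (threshold x)" and ?\<tau> = "\<sigma> \<union> set (take i \<beta>)" and ?S = "{v. x v \<noteq> 0}"
  have xs: "x \<in> closed_simplex s" and \<sigma>: "\<sigma> \<noteq> {}" "\<sigma> \<inter> set \<beta> = {}" "\<sigma> \<union> set \<beta> = s" and \<beta>: "distinct \<beta>"
    using s x by (auto simp: splittings_def piece_def)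
  have high: "\<And>v. v \<in> \<sigma> \<Longrightarrow> ?y v = threshold x" and low: "\<And>v. v \<in> set \<beta> \<Longrightarrow> ?y v = x v"
    and srt: "\<And>j k. j < k \<Longrightarrow> k < length \<beta> \<Longrightarrow> x (\<beta> ! k) \<le> x (\<beta> ! j)"
    using x by (auto simp: piece_def sorted_wrt_iff_nth_less min_def)
  have srt': "x (\<beta> ! k) \<le> x (\<beta> ! j)" if "j \<le> k" "k < length \<beta>" for j k
    using srt[of j k] that by (cases "j = k") auto
  have fin: "finite ?\<tau>" "finite ?S"
    using s(1) \<sigma> closed_simplex_support(1)[OF xs s(1)] finite_subset by (auto intro: finite_subset)
  have "Min (?y ` ?\<tau>) = level \<beta> x i"
  proof (rule Min_eqI)
    show "finite (?y ` ?\<tau>)" using fin by simp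
    show "level \<beta> x i \<in> ?y ` ?\<tau>"
    proof (cases "i = 0")
      case True
      then show ?thesis using \<sigma>(1) high by (force simp: level_def)
    next
      case False
      then have "\<beta> ! (i - 1) \<in> set (take i \<beta>)" "\<beta> ! (i - 1) \<in> set \<beta>"
        using i by (auto simp: in_set_conv_nth intro!: exI[of _ "i - 1"])
      moreover then have "level \<beta> x i = ?y (\<beta> ! (i - 1))" using low False i by (simp add: level_def)
      ultimately show ?thesis by blast
    qed
  next
    fix z assume "z \<in> ?y ` ?\<tau>"
    then obtain v where v: "v \<in> ?\<tau>" "z = ?y v" by blast
    consider "v \<in> \<sigma>" | j where "j < i" "v = \<beta> ! j"
      using v(1) by (auto simp: in_set_conv_nth)
    then show "level \<beta> x i \<le> z"
    proof cases
      case 1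
      have "level \<beta> x i \<le> threshold x"
        using x i by (auto simp: level_def piece_def)
      then show ?thesis using v high 1 by simp
    next
      case 2
      then show ?thesis using v low srt'[of j "i - 1"] i by (auto simp: level_def)
    qed
  qed
  moreover have "Max (insert 0 (?y ` (?S - ?\<tau>))) = level \<beta> x (Suc i)"
  proof (rule Max_eqI)
    show "finite (insert 0 (?y ` (?S - ?\<tau>)))" using fin by simp
    show "level \<beta> x (Suc i) \<in> insert 0 (?y ` (?S - ?\<tau>))"
    \<comment> \<open>In the second case there is no next vertex in the support, the level is 0, and
      the inserted 0 attains it.\<close>
    proof (cases "i < length \<beta> \<and> x (\<beta> ! i) \<noteq> 0")
      case True
      have "\<beta> ! i \<in> set \<beta>" using True by simp
      moreover have "\<beta> ! i \<notin> set (take i \<beta>)"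
        using \<beta> True by (auto simp: in_set_conv_nth nth_eq_iff_index_eq)
      ultimately have "\<beta> ! i \<in> ?S - ?\<tau>" "?y (\<beta> ! i) = level \<beta> x (Suc i)"
        using \<sigma>(2) True low by (auto simp: level_def)
      then show ?thesis by (metis imageI insertI2)
    next
      case False
      then show ?thesis by (auto simp: level_def)
    qed
  next
    fix z assume "z \<in> insert 0 (?y ` (?S - ?\<tau>))"
    moreover have "0 \<le> level \<beta> x (Suc i)" using xs by (auto simp: level_def closed_simplex_def)
    moreover have "?y v \<le> level \<beta> x (Suc i)" if "v \<in> ?S - ?\<tau>" for v
    proof -
      have "v \<in> s" using that xs by (auto simp: closed_simplex_def)
      then have "v \<in> set \<beta>" using that \<sigma> by auto
      then obtain j where j: "j < length \<beta>" "v = \<beta> ! j" by (auto simp: in_set_conv_nth)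
      have "\<not> j < i" using that j i by (auto simp: in_set_conv_nth)
      then show ?thesis using srt'[of i j] j low by (auto simp: level_def)
    qed
    ultimately show "z \<le> level \<beta> x (Suc i)" by blast
  qed
  ultimately show ?thesis by (simp add: gap_def)
qed

text \<open>Vertices of \<open>\<sigma>\<close> have the largest possible clipped value, the
  threshold, so a set missing one of them has no positive gap.\<close>

lemma gap_pos_card_ge:
  assumes s: "finite s" "(\<sigma>, \<beta>) \<in> splittings s" and x: "x \<in> piece \<sigma> \<beta>"
    and \<tau>: "finite \<tau>" "\<tau> \<noteq> {}" "0 < gap x \<tau>"
  shows "card \<sigma> \<le> card \<tau>"
proof (rule ccontr)
  assume "\<not> ?thesis"
  then obtain u where u: "u \<in> \<sigma>" "u \<notin> \<tau>" using card_mono[OF \<tau>(1)] by (meson subsetI)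
  obtain w where w: "w \<in> \<tau>" using \<tau>(2) by blast
  have "x \<in> closed_simplex s" using s x by (simp add: splittings_def piece_def)
  then have "gap x \<tau> \<le> min (x w) (threshold x) - min (x u) (threshold x)"
    using s \<tau> u w by (intro gap_le(2)) auto
  moreover have "min (x u) (threshold x) = threshold x" using x u(1) by (simp add: piece_def)
  ultimately show False using \<tau>(3) by linarith
qed

lemma card_splitting_take:
  assumes "finite s" "(\<sigma>, \<beta>) \<in> splittings s" "i \<le> length \<beta>"
  shows "card (\<sigma> \<union> set (take i \<beta>)) = card \<sigma> + i"
proof -
  have "finite \<sigma>" "\<sigma> \<inter> set (take i \<beta>) = {}" "distinct (take i \<beta>)"
    using assms(1,2) set_take_subset[of i \<beta>] by (auto simp: splittings_def)
  then show ?thesis using assms(3) by (simp add: card_Un_disjoint distinct_card)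
qed

text \<open>The factor weighs the gap, relative to the threshold, against a geometric series; this
  forces some time to reach 1 however many vertices there are. The value depends on \<open>x\<close>
  and \<open>\<sigma>\<close> only, not on a simplex or a piece.\<close>

definition time :: "('a \<Rightarrow> real) \<Rightarrow> 'a set \<Rightarrow> real" where
  "time x \<sigma> = min 1 (2 ^ card \<sigma> * gap x \<sigma> / threshold x)"

lemma time_piece:
  assumes "finite s" "(\<sigma>, \<beta>) \<in> splittings s" "x \<in> piece \<sigma> \<beta>" "i \<le> length \<beta>"
  shows "time x (\<sigma> \<union> set (take i \<beta>)) =
      min 1 (2 ^ (card \<sigma> + i) * (level \<beta> x i - level \<beta> x (Suc i)) / threshold x)"
    and "time x (\<sigma> \<union> set (take i \<beta>)) \<in> {0..1}"
proof -
  show *: "time x (\<sigma> \<union> set (take i \<beta>)) =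
      min 1 (2 ^ (card \<sigma> + i) * (level \<beta> x i - level \<beta> x (Suc i)) / threshold x)"
    using gap_piece[OF assms] card_splitting_take[OF assms(1,2,4)] by (simp add: time_def)
  have "0 < threshold x"
    using assms threshold_pos[of x s] by (simp add: splittings_def piece_def)
  then show "time x (\<sigma> \<union> set (take i \<beta>)) \<in> {0..1}"
    unfolding * using level_Suc_le[OF assms] by (auto intro!: divide_nonneg_pos mult_nonneg_nonneg)
qed

text \<open>The levels telescope from the threshold down to \<open>0\<close>, so the gaps cannot all be smaller than the
  terms of a geometric series.\<close>

lemma exists_time_eq_1:
  assumes s: "finite s" "(\<sigma>, \<beta>) \<in> splittings s" "x \<in> piece \<sigma> \<beta>"
  shows "\<exists>i\<le>length \<beta>. time x (\<sigma> \<union> set (take i \<beta>)) = 1"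
proof (rule ccontr)
  assume neg: "\<not> ?thesis"
  let ?m = "length \<beta>" and ?g = "\<lambda>i. level \<beta> x i - level \<beta> x (Suc i)"
  have \<sigma>: "finite \<sigma>" "\<sigma> \<noteq> {}" using s by (auto simp: splittings_def)
  have th: "0 < threshold x"
    using s threshold_pos[of x s] by (simp add: splittings_def piece_def)
  \<comment> \<open>Since \<open>card \<sigma>\<close> is at least 1, the exponent is at least
    \<open>Suc i\<close>; the bounds therefore sum to less than the threshold, which is the exact
    sum of the gaps.\<close>
  have "?g i < threshold x * (1 / 2) ^ Suc i" if i: "i \<le> ?m" for i
  proof -
    have "2 ^ (card \<sigma> + i) * ?g i / threshold x < 1"
      using neg i time_piece(1)[OF s i] by (auto simp: min_def split: if_splits)
    then have "2 ^ (card \<sigma> + i) * ?g i < threshold x" using th by (simp add: field_simps)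
    moreover have "2 ^ Suc i * ?g i \<le> 2 ^ (card \<sigma> + i) * ?g i"
      using level_Suc_le[OF s i] \<sigma> card_gt_0_iff[of \<sigma>]
      by (intro mult_right_mono power_increasing) auto
    ultimately show ?thesis by (simp add: field_simps)
  qed
  then have "(\<Sum>i\<le>?m. ?g i) < (\<Sum>i\<le>?m. threshold x * (1 / 2) ^ Suc i)"
    by (intro sum_strict_mono) auto
  also have "\<dots> = threshold x * (\<Sum>i\<le>?m. (1 / 2) ^ Suc i)" by (simp only: sum_distrib_left)
  also have "(\<Sum>i\<le>m. (1 / 2 :: real) ^ Suc i) = 1 - (1 / 2) ^ Suc m" for m
    by (induction m) (auto simp: field_simps)
  also have "threshold x * (1 - (1 / 2) ^ Suc ?m) < threshold x" using th by simp
  also have "(\<Sum>i\<le>?m. ?g i) = level \<beta> x 0 - level \<beta> x (Suc ?m)"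
    by (rule sum_telescope)
  finally show False by (simp add: level_def)
qed

section \<open>Projections with contractible fibres\<close>

text \<open>The contractions are chosen for each simplex separately. The fibres are related by
  \<open>incidence_face\<close>: passing to a face enlarges the fibre.\<close>

locale contracted_fibres =
  fixes K :: "'a set set" and R :: "('a set \<times> 'i set) set"
    and h :: "'a set \<Rightarrow> real \<times> ('i \<Rightarrow> real) \<Rightarrow> 'i \<Rightarrow> real" and c :: "'a set \<Rightarrow> 'i \<Rightarrow> real"
  assumes complex: "abstract_simplicial_complex K"
    and incidence_face: "(s, t) \<in> R \<Longrightarrow> s' \<subseteq> s \<Longrightarrow> s' \<noteq> {} \<Longrightarrow> (s', t) \<in> R"
    and incidence_base: "(s, t) \<in> R \<Longrightarrow> s \<in> K"
    and contraction: "s \<in> K \<Longrightarrow> continuous_map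
      (prod_topology (top_of_set {0..1}) (realization (R `` {s}))) (realization (R `` {s})) (h s)"
    and contraction_0: "s \<in> K \<Longrightarrow> p \<in> realization_points (R `` {s}) \<Longrightarrow> h s (0, p) = p"
    and contraction_1: "s \<in> K \<Longrightarrow> p \<in> realization_points (R `` {s}) \<Longrightarrow> h s (1, p) = c s"
    and centre: "s \<in> K \<Longrightarrow> c s \<in> realization_points (R `` {s})"
begin

abbreviation fibre :: "'a set \<Rightarrow> ('i \<Rightarrow> real) topology" where
  "fibre s \<equiv> realization (R `` {s})"

lemma finite_base: "s \<in> K \<Longrightarrow> finite s"
  using abstract_simplicial_complexD(1)[OF complex] .

lemma base_face: "s \<in> K \<Longrightarrow> s' \<subseteq> s \<Longrightarrow> s' \<noteq> {} \<Longrightarrow> s' \<in> K"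
  using abstract_simplicial_complexD(3)[OF complex] by blast

lemma continuous_map_fibre_face:
  assumes "s' \<subseteq> s" "s' \<noteq> {}"
  shows "continuous_map (fibre s) (fibre s') (\<lambda>p. p)"
  using incidence_face assms by (intro continuous_map_realization_mono) blast

lemma fibre_face:
  assumes "p \<in> realization_points (R `` {s})" "s' \<subseteq> s" "s' \<noteq> {}"
  shows "p \<in> realization_points (R `` {s'})"
  using continuous_map_fibre_face[OF assms(2,3)] assms(1)
  by (auto simp: continuous_map_def topspace_realization)

lemma contraction_in_fibre:
  assumes "s \<in> K" "t \<in> {0..1}" "p \<in> realization_points (R `` {s})"
  shows "h s (t, p) \<in> realization_points (R `` {s})"
  using contraction[OF assms(1)] assms(2,3) by (auto simp: continuous_map_def topspace_realization)

text \<open>The larger superlevel sets act first: their fibres are contained in those of the smaller ones, and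
  the final value lies in the fibre over the support of the shrunk point. A contraction that runs to
  time \<open>1\<close> makes the result independent of the initial value, so that it descends to the base.\<close>

definition stage :: "real \<Rightarrow> ('a \<Rightarrow> real) \<Rightarrow> nat \<Rightarrow> ('i \<Rightarrow> real) \<Rightarrow> 'i \<Rightarrow> real" where
  "stage t x j p = (if \<exists>\<sigma>. finite \<sigma> \<and> card \<sigma> = j \<and> 0 < gap x \<sigma>
     then let \<sigma> = SOME \<sigma>. finite \<sigma> \<and> card \<sigma> = j \<and> 0 < gap x \<sigma> in h \<sigma> (t * time x \<sigma>, p) else p)"

text \<open>Stages are indexed by cardinality, so a candidate superlevel set is met once, larger
  ones first. No simplex or splitting enters the formula, so the descriptions found on different
  pieces agree where these overlap.\<close>

primrec descend :: "real \<Rightarrow> ('a \<Rightarrow> real) \<Rightarrow> nat \<Rightarrow> ('i \<Rightarrow> real) \<Rightarrow> 'i \<Rightarrow> real" where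
  "descend t x 0 p = p"
| "descend t x (Suc j) p = descend t x j (stage t x (Suc j) p)"

section \<open>The iterated contraction over one piece\<close>

context
  fixes s \<sigma> \<beta>
  assumes s: "s \<in> K" and split: "(\<sigma>, \<beta>) \<in> splittings s"
begin

abbreviation chain :: "nat \<Rightarrow> 'a set" where
  "chain i \<equiv> \<sigma> \<union> set (take i \<beta>)"

lemma chain_simps:
  "finite s" "\<sigma> \<noteq> {}" "chain 0 = \<sigma>" "chain (length \<beta>) = s" "chain i \<subseteq> s" "chain i \<subseteq> chain (Suc i)"
  "\<sigma> \<subseteq> chain i" "chain i \<noteq> {}" "chain i \<in> K" "finite (chain i)" "card s = card \<sigma> + length \<beta>" "0 < card \<sigma>"
proof -
  show fin: "finite s" using s by (rule finite_base)
  have eq: "\<sigma> \<noteq> {}" "\<sigma> \<inter> set \<beta> = {}" "\<sigma> \<union> set \<beta> = s" "distinct \<beta>" using split by (auto simp: splittings_def)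
  show ne: "\<sigma> \<noteq> {}" "\<sigma> \<subseteq> chain i" "chain i \<noteq> {}" "chain 0 = \<sigma>" "chain (length \<beta>) = s" using eq by auto
  show sub: "chain i \<subseteq> s" "chain i \<subseteq> chain (Suc i)"
    using eq set_take_subset[of i \<beta>] set_take_subset_set_take[of i "Suc i" \<beta>] by auto
  show "chain i \<in> K" using base_face[OF s sub(1) ne(3)] .
  show "finite (chain i)" using sub(1) fin by (rule finite_subset)
  have "finite \<sigma>" using eq(3) fin by auto
  then show "card s = card \<sigma> + length \<beta>" "0 < card \<sigma>"
    using eq card_Un_disjoint[of \<sigma> "set \<beta>"] by (auto simp: distinct_card card_gt_0_iff)
qed

lemma card_chain:
  "i \<le> length \<beta> \<Longrightarrow> card (chain i) = card \<sigma> + i"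
  by (rule card_splitting_take[OF chain_simps(1) split])

lemma piece_simplex: "x \<in> piece \<sigma> \<beta> \<Longrightarrow> x \<in> closed_simplex s"
  using split by (simp add: splittings_def piece_def)

text \<open>Among the sets of this cardinality only \<open>chain i\<close> can have a positive gap,
  so the choice by \<open>SOME\<close> picks it. If its gap is 0, its time is 0 and the contraction
  does nothing, so one formula covers both branches.\<close>

lemma stage_piece:
  assumes x: "x \<in> piece \<sigma> \<beta>" and i: "i \<le> length \<beta>" and p: "p \<in> realization_points (R `` {chain i})"
  shows "stage t x (card \<sigma> + i) p = h (chain i) (t * time x (chain i), p)"
proof -
  let ?P = "\<lambda>\<tau>. finite \<tau> \<and> card \<tau> = card \<sigma> + i \<and> 0 < gap x \<tau>"
  have gap: "0 \<le> gap x (chain i)"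
    using gap_piece[OF chain_simps(1) split x i] level_Suc_le[OF chain_simps(1) split x i] by simp
  have uniq: "\<tau> = chain i" if "?P \<tau>" for \<tau>
    using gap_unique[OF piece_simplex[OF x] chain_simps(1), of \<tau> "chain i"] that gap
      chain_simps(10) card_chain[OF i] by simp
  show ?thesis
  proof (cases "\<exists>\<tau>. ?P \<tau>")
    case True
    then have "(SOME \<tau>. ?P \<tau>) = chain i" by (rule uniq[OF someI_ex])
    then show ?thesis using True by (simp only: stage_def Let_def if_True)
  next
    case False
    then have "\<not> ?P (chain i)" by blast
    then have "gap x (chain i) = 0"
      using gap chain_simps(10)[of i] card_chain[OF i] by auto
    then have "h (chain i) (t * time x (chain i), p) = p"
      using contraction_0[OF chain_simps(9) p] by (simp add: time_def)
    then show ?thesis using False by (simp only: stage_def if_False)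
  qed
qed

lemma stage_below:
  assumes x: "x \<in> piece \<sigma> \<beta>" and j: "0 < j" "j < card \<sigma>"
  shows "stage t x j p = p"
proof -
  \<comment> \<open>As \<open>0 < j\<close>, the empty set, whose \<open>gap\<close> contains the
    \<open>Min\<close> of an empty set, is never a candidate.\<close>
  have "\<not> (finite \<tau> \<and> card \<tau> = j \<and> 0 < gap x \<tau>)" for \<tau>
    using gap_pos_card_ge[OF chain_simps(1) split x, of \<tau>] j by (cases "\<tau> = {}") auto
  then show ?thesis by (auto simp: stage_def)
qed

lemma descend_below:
  assumes "x \<in> piece \<sigma> \<beta>" "k < card \<sigma>"
  shows "descend t x k p = p"
  using assms(2) by (induction k arbitrary: p) (simp_all add: stage_below[OF assms(1)])

lemma descend_card:
  assumes "x \<in> piece \<sigma> \<beta>"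
  shows "descend t x (card \<sigma>) p = stage t x (card \<sigma>) p"
proof -
  obtain k where k: "card \<sigma> = Suc k" using chain_simps(12) gr0_implies_Suc by blast
  then show ?thesis using descend_below[OF assms, of k] by simp
qed

lemma time_in_unit: "x \<in> piece \<sigma> \<beta> \<Longrightarrow> i \<le> length \<beta> \<Longrightarrow> time x (chain i) \<in> {0..1}"
  using time_piece(2)[OF chain_simps(1) split] by blast

lemma stage_in_fibre:
  assumes "x \<in> piece \<sigma> \<beta>" "i \<le> length \<beta>" "p \<in> realization_points (R `` {chain i})" "t \<in> {0..1}"
  shows "stage t x (card \<sigma> + i) p \<in> realization_points (R `` {chain i})"
  using time_in_unit[OF assms(1,2)] assms(4)
  unfolding stage_piece[OF assms(1-3)]
  by (intro contraction_in_fibre chain_simps assms) (auto intro: mult_le_one)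

lemma descend_0:
  assumes "x \<in> piece \<sigma> \<beta>" "i \<le> length \<beta>" "p \<in> realization_points (R `` {chain i})"
  shows "descend 0 x (card \<sigma> + i) p = p"
  using assms(2,3)
proof (induction i)
  case 0
  then show ?case
    using descend_card[OF assms(1)] stage_piece[OF assms(1), of 0 p 0] contraction_0[OF chain_simps(9)[of 0]]
    by simp
next
  case (Suc i)
  have "stage 0 x (card \<sigma> + Suc i) p = p"
    using stage_piece[OF assms(1) Suc.prems, of 0] contraction_0[OF chain_simps(9) Suc.prems(2)] by simp
  then show ?case
    using Suc fibre_face[OF Suc.prems(2) chain_simps(6,8)] by simp
qed

text \<open>The stage of \<open>chain k\<close> runs to time 1 and sends every point to
  \<open>c (chain k)\<close>, so all later stages start from the same point. The earlier stages only
  have to keep both points in the fibres.\<close>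

lemma descend_1_constant:
  assumes x: "x \<in> piece \<sigma> \<beta>"
    and "i \<le> length \<beta>" "p \<in> realization_points (R `` {chain i})" "p' \<in> realization_points (R `` {chain i})"
    and "k \<le> i" "time x (chain k) = 1"
  shows "descend 1 x (card \<sigma> + i) p = descend 1 x (card \<sigma> + i) p'"
  using assms(2-)
proof (induction i arbitrary: p p')
  case 0
  then have "time x (chain 0) = 1" by simp
  then have "stage 1 x (card \<sigma> + 0) q = c (chain 0)" if "q \<in> realization_points (R `` {chain 0})" for q
    using stage_piece[OF x 0(1) that] contraction_1[OF chain_simps(9) that] by simp
  then show ?case
    using descend_card[OF x] 0 by simp
next
  case (Suc i)
  let ?S = "stage 1 x (card \<sigma> + Suc i)"
  show ?case
  proof (cases "k = Suc i")
    case True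
    then have "?S q = c (chain (Suc i))" if "q \<in> realization_points (R `` {chain (Suc i)})" for q
      using stage_piece[OF x Suc.prems(1) that] contraction_1[OF chain_simps(9) that] Suc.prems(5) by simp
    then show ?thesis using Suc.prems by simp
  next
    case False
    have "?S q \<in> realization_points (R `` {chain i})" if "q \<in> realization_points (R `` {chain (Suc i)})" for q
      using fibre_face[OF stage_in_fibre[OF x Suc.prems(1) that, of 1] chain_simps(6,8)] by simp
    then show ?thesis using Suc False by simp
  qed
qed

lemma descend_1_independent:
  assumes x: "x \<in> piece \<sigma> \<beta>"
    and "p \<in> realization_points (R `` {s})" "p' \<in> realization_points (R `` {s})"
  shows "descend 1 x (card s) p = descend 1 x (card s) p'"
proof -
  obtain k where "k \<le> length \<beta>" "time x (chain k) = 1"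
    using exists_time_eq_1[OF chain_simps(1) split x] by blast
  then show ?thesis
    using descend_1_constant[OF x order_refl, of p p' k] assms chain_simps(4,11) by simp
qed

lemma continuous_map_time:
  assumes i: "i \<le> length \<beta>"
  shows "continuous_map (subtopology (powertop_real UNIV) (piece \<sigma> \<beta>)) (top_of_set {0..1})
    (\<lambda>x. time x (chain i))"
proof -
  let ?X = "subtopology (powertop_real UNIV) (piece \<sigma> \<beta>)"
  have sub: "piece \<sigma> \<beta> \<subseteq> closed_simplex s" using piece_simplex by blast
  have th: "continuous_map ?X euclideanreal threshold"
    using continuous_map_from_subtopology_mono[OF continuous_map_threshold[OF chain_simps(1)] sub] .
  have co: "continuous_map ?X euclideanreal (\<lambda>x. x v)" for v
    by (intro continuous_map_from_subtopology continuous_map_product_projection) simp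
  have lv: "continuous_map ?X euclideanreal (\<lambda>x. level \<beta> x j)" for j
    unfolding level_def using th co by simp
  have "continuous_map ?X euclideanreal (\<lambda>x. time x (chain i))"
  proof (rule continuous_map_eq)
    show "continuous_map ?X euclideanreal
        (\<lambda>x. min 1 (2 ^ (card \<sigma> + i) * (level \<beta> x i - level \<beta> x (Suc i)) / threshold x))"
    proof (intro continuous_intros th lv)
      fix x assume "x \<in> topspace ?X"
      then have "x \<in> closed_simplex s" using sub by auto
      then show "threshold x \<noteq> 0" using threshold_pos[of x s] chain_simps(1) by simp
    qed auto
  next
    fix x assume "x \<in> topspace ?X"
    then show "min 1 (2 ^ (card \<sigma> + i) * (level \<beta> x i - level \<beta> x (Suc i)) / threshold x) = time x (chain i)"
      using time_piece(1)[OF chain_simps(1) split _ i, of x] by simp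
  qed
  then show ?thesis
    using time_in_unit[OF _ i] by (auto simp: continuous_map_in_subtopology)
qed

lemma continuous_map_stage:
  assumes i: "i \<le> length \<beta>"
  shows "continuous_map (prod_topology (top_of_set {0..1})
      (prod_topology (subtopology (powertop_real UNIV) (piece \<sigma> \<beta>)) (fibre (chain i))))
    (fibre (chain i)) (\<lambda>(t, x, p). stage t x (card \<sigma> + i) p)" (is "continuous_map ?D _ _")
proof (rule continuous_map_eq)
  have t: "continuous_map ?D euclideanreal fst" by (rule continuous_map_fst_real)
  have x: "continuous_map ?D (subtopology (powertop_real UNIV) (piece \<sigma> \<beta>)) (\<lambda>z. fst (snd z))"
    and p: "continuous_map ?D (fibre (chain i)) (\<lambda>z. snd (snd z))"
    using continuous_map_compose[OF continuous_map_snd continuous_map_fst]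
      continuous_map_compose[OF continuous_map_snd continuous_map_snd] by (simp_all add: o_def)
  have "continuous_map ?D (top_of_set {0..1}) (\<lambda>z. time (fst (snd z)) (chain i))"
    using continuous_map_compose[OF x continuous_map_time[OF i]] by (simp add: o_def)
  then have "continuous_map ?D euclideanreal (\<lambda>z. time (fst (snd z)) (chain i))"
    by (simp add: continuous_map_in_subtopology)
  with t have "continuous_map ?D euclideanreal (\<lambda>z. fst z * time (fst (snd z)) (chain i))"
    by (rule continuous_map_real_mult)
  moreover have "fst z * time (fst (snd z)) (chain i) \<in> {0..1}" if "z \<in> topspace ?D" for z
    using that time_in_unit[OF _ i, of "fst (snd z)"] by (auto intro: mult_le_one)
  ultimately have "continuous_map ?D (top_of_set {0..1}) (\<lambda>z. fst z * time (fst (snd z)) (chain i))"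
    by (auto simp: continuous_map_in_subtopology)
  with p have "continuous_map ?D (prod_topology (top_of_set {0..1}) (fibre (chain i)))
      (\<lambda>z. (fst z * time (fst (snd z)) (chain i), snd (snd z)))"
    by (simp add: continuous_map_pairwise o_def)
  from continuous_map_compose[OF this contraction[OF chain_simps(9)]]
  show "continuous_map ?D (fibre (chain i)) (\<lambda>z. h (chain i) (fst z * time (fst (snd z)) (chain i), snd (snd z)))"
    by (simp add: o_def)
next
  fix z assume "z \<in> topspace ?D"
  then show "h (chain i) (fst z * time (fst (snd z)) (chain i), snd (snd z)) =
      (case z of (t, x, p) \<Rightarrow> stage t x (card \<sigma> + i) p)"
    using stage_piece[OF _ i] by (auto simp: topspace_realization)
qed

text \<open>Each stage maps a fibre to itself and is followed by the inclusion into the larger fibre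
  over the next smaller set of the chain, ending over \<open>\<sigma>\<close>.\<close>

lemma continuous_map_descend:
  assumes "i \<le> length \<beta>"
  shows "continuous_map (prod_topology (top_of_set {0..1})
      (prod_topology (subtopology (powertop_real UNIV) (piece \<sigma> \<beta>)) (fibre (chain i))))
    (fibre \<sigma>) (\<lambda>(t, x, p). descend t x (card \<sigma> + i) p)"
  using assms
proof (induction i)
  case 0
  show ?case
    unfolding add_0_right chain_simps(3)
    by (rule continuous_map_eq[OF continuous_map_stage[OF 0, unfolded add_0_right chain_simps(3)]])
      (auto simp: descend_card)
next
  case (Suc i)
  let ?T = "top_of_set {0..1::real}" and ?X = "subtopology (powertop_real UNIV) (piece \<sigma> \<beta>)"
  let ?D = "prod_topology ?T (prod_topology ?X (fibre (chain (Suc i))))"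
  have "continuous_map ?D (fibre (chain i)) (\<lambda>(t, x, p). stage t x (card \<sigma> + Suc i) p)"
    using continuous_map_compose[OF continuous_map_stage[OF Suc.prems] continuous_map_fibre_face[OF chain_simps(6,8)]]
    by (simp add: o_def)
  moreover have "continuous_map ?D ?X (\<lambda>z. fst (snd z))"
    using continuous_map_compose[OF continuous_map_snd continuous_map_fst] by (simp add: o_def)
  ultimately have "continuous_map ?D (prod_topology ?T (prod_topology ?X (fibre (chain i))))
      (\<lambda>z. (fst z, fst (snd z), stage (fst z) (fst (snd z)) (card \<sigma> + Suc i) (snd (snd z))))"
    by (simp add: continuous_map_pairwise o_def case_prod_unfold continuous_map_fst)
  from continuous_map_compose[OF this Suc.IH] Suc.prems
  show ?case by (simp add: o_def case_prod_unfold)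
qed

end

section \<open>Gluing the pieces and the homotopy inverse\<close>

lemma continuous_map_shrink_descend:
  assumes s: "s \<in> K"
  shows "continuous_map (prod_topology (top_of_set {0..1}) (prod_topology (simplex_topology s) (fibre s)))
    (product_complex R) (\<lambda>(t, x, p). (shrink x, descend t x (card s) p))"
proof (rule continuous_map_from_pieces[OF finite_base[OF s]])
  fix \<sigma> \<beta> assume split: "(\<sigma>, \<beta>) \<in> splittings s"
  let ?X = "subtopology (powertop_real UNIV) (piece \<sigma> \<beta>)"
  let ?D = "prod_topology (top_of_set {0..1::real}) (prod_topology ?X (fibre s))"
  note chain = chain_simps[OF s split]
  have sub: "piece \<sigma> \<beta> \<subseteq> closed_simplex s" using piece_simplex[OF s split] by blast
  \<comment> \<open>On the piece only vertices of \<open>\<sigma>\<close> can exceed the threshold.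
    Both components thus end over \<open>\<sigma>\<close>, and the pair lies in the product
    complex.\<close>
  have "shrink x \<in> closed_simplex \<sigma>" if "x \<in> piece \<sigma> \<beta>" for x
    using that sub split by (intro shrink_in_closed_simplex[OF _ chain(1)]) (auto simp: piece_def splittings_def)
  moreover have "continuous_map ?X (simplex_topology s) shrink"
    using continuous_map_from_subtopology_mono[OF continuous_map_shrink[OF chain(1)] sub] .
  ultimately have "continuous_map ?X (simplex_topology \<sigma>) shrink"
    by (auto simp: continuous_map_into_simplex_topology)
  from continuous_map_compose[OF continuous_map_compose[OF continuous_map_snd continuous_map_fst] this]
  have "continuous_map ?D (simplex_topology \<sigma>) (\<lambda>z. shrink (fst (snd z)))" by (simp add: o_def)
  moreover have "continuous_map ?D (fibre \<sigma>) (\<lambda>(t, x, p). descend t x (card s) p)"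
    using continuous_map_descend[OF s split order_refl] chain by simp
  ultimately have "continuous_map ?D (prod_topology (simplex_topology \<sigma>) (fibre \<sigma>))
      (\<lambda>(t, x, p). (shrink x, descend t x (card s) p))"
    by (simp add: continuous_map_pairwise o_def case_prod_unfold)
  moreover have "finite \<sigma>" using chain(10)[of 0] by simp
  ultimately show "continuous_map ?D (product_complex R) (\<lambda>(t, x, p). (shrink x, descend t x (card s) p))"
    using continuous_map_compose continuous_map_simplex_times_fibre by (fastforce simp: o_def)
qed

text \<open>A positive gap forces a set into the support, so stages beyond the size of the support
  are idle. Hence the count may start from any simplex containing \<open>x\<close>.\<close>

lemma descend_above:
  assumes x: "x \<in> closed_simplex s" "finite s" and "card {v. x v \<noteq> 0} \<le> N"
  shows "descend t x N p = descend t x (card {v. x v \<noteq> 0}) p"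
  using assms(3)
proof (induction N rule: dec_induct)
  case (step N)
  have "\<not> (finite \<tau> \<and> card \<tau> = Suc N \<and> 0 < gap x \<tau>)" for \<tau>
  proof
    assume \<tau>: "finite \<tau> \<and> card \<tau> = Suc N \<and> 0 < gap x \<tau>"
    have "finite {v. x v \<noteq> 0}" using closed_simplex_support(1)[OF x] x(2) by (rule finite_subset)
    then have "card \<tau> \<le> card {v. x v \<noteq> 0}"
      using gap_pos_subset_support[OF x] \<tau> by (intro card_mono) auto
    then show False using \<tau> step by simp
  qed
  then have "stage t x (Suc N) p = p" by (auto simp: stage_def)
  then show ?case using step by simp
qed simp

lemma support_base:
  assumes "x \<in> closed_simplex s" "s \<in> K"
  shows "{v. x v \<noteq> 0} \<in> K" "{v. x v \<noteq> 0} \<subseteq> s" "{v. x v \<noteq> 0} \<noteq> {}" "x \<in> closed_simplex {v. x v \<noteq> 0}"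
    "card {v. x v \<noteq> 0} \<le> card s"
  using closed_simplex_support[OF assms(1) finite_base[OF assms(2)]] base_face[OF assms(2)]
    card_mono[OF finite_base[OF assms(2)]] by simp_all

text \<open>The starting point \<open>c S\<close> is an arbitrary choice in the fibre over the
  support; at time 1 the result no longer depends on it.\<close>

definition lift :: "('a \<Rightarrow> real) \<Rightarrow> ('a \<Rightarrow> real) \<times> ('i \<Rightarrow> real)" where
  "lift x = (let S = {v. x v \<noteq> 0} in (shrink x, descend 1 x (card S) (c S)))"

text \<open>Frees \<open>lift\<close> from the support: with the constant start \<open>c s\<close>
  it becomes visibly continuous on the simplex of \<open>s\<close>, and with the second coordinate
  of a point as start it is the end of a homotopy.\<close>

lemma lift_eq:
  assumes x: "x \<in> closed_simplex s" and s: "s \<in> K" and p: "p \<in> realization_points (R `` {s})"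
  shows "lift x = (shrink x, descend 1 x (card s) p)"
proof -
  let ?S = "{v. x v \<noteq> 0}"
  note S = support_base[OF x s]
  obtain \<sigma> \<beta> where "(\<sigma>, \<beta>) \<in> splittings ?S" "x \<in> piece \<sigma> \<beta>"
    using splittings_pieces_cover[OF S(4) finite_base[OF S(1)]] by blast
  then have "descend 1 x (card ?S) p = descend 1 x (card ?S) (c ?S)"
    using descend_1_independent[OF S(1)] fibre_face[OF p S(2,3)] centre[OF S(1)] by blast
  moreover have "descend 1 x (card s) p = descend 1 x (card ?S) p"
    using descend_above[OF x finite_base[OF s] S(5)] .
  ultimately show ?thesis by (simp only: lift_def Let_def)
qed

lemma continuous_map_lift: "continuous_map (realization K) (product_complex R) lift"
proof (rule continuous_map_realization)
  fix s assume s: "s \<in> K"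
  have "continuous_map (simplex_topology s)
      (prod_topology (top_of_set {0..1}) (prod_topology (simplex_topology s) (fibre s)))
      (\<lambda>x. (1::real, x, c s))"
    using centre[OF s] by (simp add: continuous_map_pairwise o_def topspace_realization)
  from continuous_map_compose[OF this continuous_map_shrink_descend[OF s]]
  show "continuous_map (simplex_topology s) (product_complex R) lift"
    by (rule continuous_map_eq) (simp add: lift_eq[OF _ s centre[OF s]])
qed

lemma homotopy_equivalence_map_fst:
  "homotopy_equivalence_map (product_complex R) (realization K) fst"
proof -
  let ?B = "product_complex R" and ?T = "top_of_set {0..1::real}"
  have fst: "continuous_map ?B (realization K) fst"
  proof (rule continuous_map_product_complex)
    fix s t assume "(s, t) \<in> R"
    from continuous_map_compose[OF continuous_map_fst continuous_map_simplex_inclusion[OF incidence_base[OF this]]]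
    show "continuous_map (prod_topology (simplex_topology s) (simplex_topology t)) (realization K) fst"
      by (simp add: o_def)
  qed
  \<comment> \<open>The first component of \<open>lift\<close> is \<open>shrink\<close>, which the
    straight line joins to the identity inside each simplex.\<close>
  have "continuous_map (prod_topology ?T (realization K)) (realization K) shrink_homotopy"
  proof (intro continuous_map_prod_realization compact_Hausdorff_unit_interval)
    fix s assume s: "s \<in> K"
    from continuous_map_compose[OF continuous_map_shrink_homotopy[OF finite_base[OF s]]
        continuous_map_simplex_inclusion[OF s]]
    show "continuous_map (prod_topology ?T (simplex_topology s)) (realization K) shrink_homotopy"
      by (simp add: o_def)
  qed
  then have "homotopic_with (\<lambda>_. True) (realization K) (realization K) id (fst \<circ> lift)"
    by (rule homotopic_withI) (auto simp: shrink_homotopy_def lift_def Let_def)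
  then have down: "homotopic_with (\<lambda>_. True) (realization K) (realization K) (fst \<circ> lift) id"
    by (rule homotopic_with_sym[THEN iffD1])
  \<comment> \<open>First half of the homotopy: only the first coordinate moves, and it stays in its
    simplex, so no cell is left.\<close>
  have "continuous_map (prod_topology ?T ?B) ?B (\<lambda>(t, x, p). (shrink_homotopy (t, x), p))"
  proof (intro continuous_map_prod_product_complex compact_Hausdorff_unit_interval)
    fix s t assume st: "(s, t) \<in> R"
    let ?D = "prod_topology ?T (prod_topology (simplex_topology s) (simplex_topology t))"
    have fin: "finite s" using incidence_base[OF st] by (rule finite_base)
    have "continuous_map ?D (prod_topology ?T (simplex_topology s)) (\<lambda>z. (fst z, fst (snd z)))"
      using continuous_map_compose[OF continuous_map_snd continuous_map_fst]
      by (simp add: continuous_map_pairwise o_def continuous_map_fst)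
    from continuous_map_compose[OF this continuous_map_shrink_homotopy[OF fin]]
      continuous_map_compose[OF continuous_map_snd continuous_map_snd]
    have "continuous_map ?D (prod_topology (simplex_topology s) (simplex_topology t))
        (\<lambda>z. (shrink_homotopy (fst z, fst (snd z)), snd (snd z)))"
      by (simp add: continuous_map_pairwise o_def)
    from continuous_map_compose[OF this continuous_map_cell_product_complex[OF st]]
    show "continuous_map ?D ?B (\<lambda>(t, x, p). (shrink_homotopy (t, x), p))"
      by (simp add: o_def case_prod_unfold)
  qed
  then have 1: "homotopic_with (\<lambda>_. True) ?B ?B id (\<lambda>(x, p). (shrink x, p))"
    by (rule homotopic_withI) (auto simp: shrink_homotopy_def)
  \<comment> \<open>Second half: the first coordinate rests at \<open>shrink x\<close> while the
    second descends. Counting from the support makes the formula global; on a cell it equals the one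
    counted from \<open>s\<close>.\<close>
  let ?H = "\<lambda>(t, x, p). (shrink x, descend t x (card {v. x v \<noteq> 0}) p)"
  have "continuous_map (prod_topology ?T ?B) ?B ?H"
  proof (intro continuous_map_prod_product_complex compact_Hausdorff_unit_interval)
    fix s t assume st: "(s, t) \<in> R"
    let ?D = "prod_topology ?T (prod_topology (simplex_topology s) (simplex_topology t))"
    have s: "s \<in> K" using incidence_base[OF st] .
    have "continuous_map (simplex_topology t) (fibre s) (\<lambda>p. p)"
      using st by (intro continuous_map_simplex_inclusion) auto
    from continuous_map_compose[OF continuous_map_compose[OF continuous_map_snd continuous_map_snd] this]
    have "continuous_map ?D (fibre s) (\<lambda>z. snd (snd z))" by (simp add: o_def)
    moreover have "continuous_map ?D (simplex_topology s) (\<lambda>z. fst (snd z))"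
      using continuous_map_compose[OF continuous_map_snd continuous_map_fst] by (simp add: o_def)
    ultimately have "continuous_map ?D (prod_topology ?T (prod_topology (simplex_topology s) (fibre s))) (\<lambda>z. z)"
      by (simp add: continuous_map_pairwise o_def continuous_map_fst)
    from continuous_map_compose[OF this continuous_map_shrink_descend[OF s]]
    show "continuous_map ?D ?B ?H"
      by (rule continuous_map_eq)
        (auto simp: descend_above[OF _ finite_base[OF s] support_base(5)[OF _ s]])
  qed
  then have 2: "homotopic_with (\<lambda>_. True) ?B ?B (\<lambda>(x, p). (shrink x, p)) (lift \<circ> fst)"
  proof (rule homotopic_withI)
    fix z assume "z \<in> topspace ?B"
    then obtain s t x p where st: "(s, t) \<in> R" and z: "z = (x, p)" "x \<in> closed_simplex s" "p \<in> closed_simplex t"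
      by (auto simp: topspace_product_complex)
    let ?S = "{v. x v \<noteq> 0}"
    have s: "s \<in> K" using incidence_base[OF st] .
    note S = support_base[OF z(2) s]
    have p: "p \<in> realization_points (R `` {s})" using st z by (auto simp: realization_points_def)
    then have pS: "p \<in> realization_points (R `` {?S})" using fibre_face S by blast
    obtain \<sigma> \<beta> where split: "(\<sigma>, \<beta>) \<in> splittings ?S" "x \<in> piece \<sigma> \<beta>"
      using splittings_pieces_cover[OF S(4) finite_base[OF S(1)]] by blast
    have "descend 0 x (card ?S) p = p"
      using descend_0[OF S(1) split order_refl, of p] pS chain_simps(4,11)[OF S(1) split(1)] by simp
    then show "?H (0, z) = (case z of (x, p) \<Rightarrow> (shrink x, p))" using z by simp
    show "?H (1, z) = (lift \<circ> fst) z" using z lift_eq[OF S(4,1) pS] by simp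
  qed
  have "homotopic_with (\<lambda>_. True) ?B ?B (lift \<circ> fst) id"
    using homotopic_with_trans[OF 1 2] by (rule homotopic_with_sym[THEN iffD1])
  with fst down continuous_map_lift show ?thesis
    unfolding homotopy_equivalence_map_def by (intro conjI exI[of _ lift])
qed

end

lemma homotopy_equivalence_map_contractible_fibres:
  assumes "abstract_simplicial_complex K"
    and "\<And>s t s'. (s, t) \<in> R \<Longrightarrow> s' \<subseteq> s \<Longrightarrow> s' \<noteq> {} \<Longrightarrow> (s', t) \<in> R"
    and "\<And>s t. (s, t) \<in> R \<Longrightarrow> s \<in> K"
    and ne: "\<And>s. s \<in> K \<Longrightarrow> realization_points (R `` {s}) \<noteq> {}"
    and contr: "\<And>s. s \<in> K \<Longrightarrow> contractible_space (realization (R `` {s}))"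
  shows "homotopy_equivalence_map (product_complex R) (realization K) fst"
proof -
  have "\<exists>h c. continuous_map (prod_topology (top_of_set {0..1}) (realization (R `` {s}))) (realization (R `` {s})) h \<and>
      (\<forall>p\<in>realization_points (R `` {s}). h (0::real, p) = p \<and> h (1, p) = c)" if s: "s \<in> K" for s
  proof -
    obtain c where "homotopic_with (\<lambda>_. True) (realization (R `` {s})) (realization (R `` {s})) id (\<lambda>_. c)"
      using contr[OF s] unfolding contractible_space_def by blast
    then obtain h where "continuous_map (prod_topology (top_of_set {0..1}) (realization (R `` {s}))) (realization (R `` {s})) h"
      "\<forall>p. h (0::real, p) = id p" "\<forall>p. h (1, p) = c"
      unfolding homotopic_with_def by blast
    then show ?thesis by (intro exI[of _ h] exI[of _ c]) simp
  qed
  then obtain h c where h: "\<And>s. s \<in> K \<Longrightarrow>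
      continuous_map (prod_topology (top_of_set {0..1}) (realization (R `` {s}))) (realization (R `` {s})) (h s)"
    "\<And>s p. s \<in> K \<Longrightarrow> p \<in> realization_points (R `` {s}) \<Longrightarrow> h s (0, p) = p \<and> h s (1::real, p) = c s"
    by metis
  \<comment> \<open>A point of the non-empty fibre is carried to \<open>c s\<close> at time 1, and
    the homotopy does not leave the fibre.\<close>
  have c: "c s \<in> realization_points (R `` {s})" if s: "s \<in> K" for s
  proof -
    obtain p where "p \<in> realization_points (R `` {s})" using ne[OF s] by blast
    then have "(1::real, p) \<in> topspace (prod_topology (top_of_set {0..1}) (realization (R `` {s})))" "h s (1, p) = c s"
      using h(2)[OF s] by (simp_all add: topspace_realization)
    then show ?thesis
      using subsetD[OF continuous_map_image_subset_topspace[OF h(1)[OF s]], of "h s (1, p)"]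
      by (simp add: topspace_realization image_eqI[of _ _ "(1, p)"])
  qed
  interpret contracted_fibres K R h c
  proof
    show "abstract_simplicial_complex K" by (fact assms(1))
  qed (use assms(2,3) h c in blast)+
  show ?thesis by (rule homotopy_equivalence_map_fst)
qed

section \<open>The blowup complex\<close>

definition blowup_incidence :: "'i set \<Rightarrow> ('i \<Rightarrow> 'a set set) \<Rightarrow> ('a set \<times> 'i set) set" where
  "blowup_incidence I A = {(s, J). J \<in> nerve I A \<and> s \<in> (\<Inter>i\<in>J. A i)}"

text \<open>A class is determined by its pair \<open>(x, p)\<close>, and the support of
  \<open>p\<close> is the smallest \<open>J\<close> representing it. Continuity is checked through
  the quotient map in one direction and cell by cell in the other.\<close>

lemma homeomorphic_maps_blowup:
  fixes A :: "'i \<Rightarrow> 'a set set"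
  assumes K: "abstract_simplicial_complex K" and A: "\<And>i. i \<in> I \<Longrightarrow> subcomplex (A i) K"
  defines "U \<equiv> \<lambda>i. topspace (realization (A i))"
  shows "homeomorphic_maps (blowup (realization K) I U) (product_complex (blowup_incidence I A))
    (\<lambda>C. (rho_S C, rho_N C)) (\<lambda>(x, p). blowup_rel I U `` {({i. p i \<noteq> 0}, x, p)})"
proof -
  let ?R = "blowup_incidence I A" and ?P = "blowup_pieces (realization K) I U"
    and ?B = "blowup (realization K) I U"
  let ?q = "\<lambda>z. blowup_rel I U `` {z}"
  have cA: "abstract_simplicial_complex (A i)" if "i \<in> I" for i
    using A[OF that] by (simp add: subcomplex_def)
  have AK: "A i \<subseteq> K" if "i \<in> I" for i
    using A[OF that] by (simp add: subcomplex_def)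
  have UK: "\<forall>i\<in>I. U i \<subseteq> topspace (realization K)"
    using AK by (force simp: U_def topspace_realization realization_points_def)
  have N: "nerve I U = nerve I A"
    unfolding U_def using cA by (intro nerve_realization) blast
  have finJ: "finite J" "J \<noteq> {}" "J \<subseteq> I" if "J \<in> nerve I A" for J
    using that by (auto simp: nerve_def)
  have cJ: "abstract_simplicial_complex (\<Inter>i\<in>J. A i)" if J: "J \<in> nerve I A" for J
    using finJ[OF J] cA by (intro abstract_simplicial_complex_INT) auto
  \<comment> \<open>A point lies in the realization of each \<open>A i\<close> exactly if its
    support is a simplex of each, hence of the intersection.\<close>
  have UJ: "(\<Inter>i\<in>J. U i) = realization_points (\<Inter>i\<in>J. A i)" if J: "J \<in> nerve I A" for J
  proof -
    have "x \<in> U i \<longleftrightarrow> {v. x v \<noteq> 0} \<in> A i \<and> x \<in> closed_simplex {v. x v \<noteq> 0}" if "i \<in> J" for x i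
      unfolding U_def topspace_realization
      using realization_points_iff_support[OF cA] that finJ(3)[OF J] by blast
    then show ?thesis
      using finJ(2)[OF J] by (auto simp: realization_points_iff_support[OF cJ[OF J]])
  qed
  have top: "prod_topology (subtopology (realization K) (\<Inter>i\<in>J. U i)) (realization (full_simplex J)) =
      prod_topology (realization (\<Inter>i\<in>J. A i)) (simplex_topology J)" if J: "J \<in> nerve I A" for J
  proof -
    have "(\<Inter>i\<in>J. A i) \<subseteq> K" using finJ[OF J] AK by blast
    then have "subcomplex (\<Inter>i\<in>J. A i) K" using cJ[OF J] by (simp add: subcomplex_def)
    then show ?thesis
      using finJ[OF J] K
      by (simp add: UJ[OF J] subtopology_realization_subcomplex realization_full_simplex)
  qed
  have P: "?P = sum_topology (\<lambda>J. prod_topology (realization (\<Inter>i\<in>J. A i)) (simplex_topology J)) (nerve I A)"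
    unfolding blowup_pieces_def N using top by (rule sum_topology_cong)
  have topP: "topspace ?P = {(J, x, p). J \<in> nerve I A \<and> x \<in> realization_points (\<Inter>i\<in>J. A i) \<and> p \<in> closed_simplex J}"
    unfolding P by (auto simp: topspace_realization)
  have q: "quotient_map ?P ?B ?q"
    unfolding blowup_def using equiv_blowup_rel[OF UK] by (rule quotient_map_quotient_topology)
  have rho: "rho_S (?q (J, x, p)) = x" "rho_N (?q (J, x, p)) = p" if "(J, x, p) \<in> topspace ?P" for J x p
    using rho_class[OF UK that] by auto
  have glue: "?q ({i. p i \<noteq> 0}, x, p) = ?q (J, x, p)" and suppP: "({i. p i \<noteq> 0}, x, p) \<in> topspace ?P"
    if "(J, x, p) \<in> topspace ?P" for J x p
  proof -
    let ?s = "{i. p i \<noteq> 0}"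
    have J: "J \<in> nerve I A" and x: "x \<in> (\<Inter>i\<in>J. U i)" and p: "p \<in> closed_simplex J"
      using that UJ by (auto simp: topP)
    note supp = closed_simplex_support[OF p finJ(1)[OF J]]
    have s: "?s \<in> nerve I A"
      using abstract_simplicial_complexD(3)[OF abstract_simplicial_complex_nerve J supp(1,2)] .
    have "p \<in> realization_points (full_simplex ?s)"
      using supp(2,3) unfolding realization_points_def full_simplex_def by blast
    then have "((?s, x, p), (J, x, p)) \<in> blowup_glue I U"
      unfolding blowup_glue_def N using s J supp(1) x by blast
    then have "((?s, x, p), (J, x, p)) \<in> blowup_rel I U"
      unfolding blowup_rel_def by blast
    then show "?q (?s, x, p) = ?q (J, x, p)"
      by (rule equiv_class_eq[OF equiv_blowup_rel[OF UK]])
    show "(?s, x, p) \<in> topspace ?P"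
      using s supp(1,3) x by (auto simp: topP UJ[symmetric])
  qed
  have mem: "(x, p) \<in> topspace (product_complex ?R) \<longleftrightarrow> (\<exists>J. (J, x, p) \<in> topspace ?P)" for x p
    by (auto simp: topspace_product_complex topP blowup_incidence_def realization_points_def)
  have fib: "?R\<inverse> `` {J} = (\<Inter>i\<in>J. A i)" if "J \<in> nerve I A" for J
    using that by (auto simp: blowup_incidence_def)
  have "continuous_map ?P (product_complex ?R) snd"
    unfolding P
  proof (intro continuous_map_from_sum_topology)
    fix J assume J: "J \<in> nerve I A"
    show "continuous_map (prod_topology (realization (\<Inter>i\<in>J. A i)) (simplex_topology J)) (product_complex ?R) (\<lambda>y. snd (J, y))"
      using continuous_map_fibre_times_simplex[OF finJ(1)[OF J], of ?R] by (simp add: fib[OF J])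
  qed
  then have "continuous_map ?P (product_complex ?R) ((\<lambda>C. (rho_S C, rho_N C)) \<circ> ?q)"
    by (rule continuous_map_eq) (auto simp: rho)
  then have c1: "continuous_map ?B (product_complex ?R) (\<lambda>C. (rho_S C, rho_N C))"
    by (rule continuous_compose_quotient_map[OF q])
  \<comment> \<open>The representative by the support jumps when coordinates vanish; on the cell of
    \<open>(s, J)\<close> gluing replaces it by the one with constant first component
    \<open>J\<close>.\<close>
  have c2: "continuous_map (product_complex ?R) ?B (\<lambda>(x, p). ?q ({i. p i \<noteq> 0}, x, p))"
  proof (rule continuous_map_product_complex)
    fix s J assume sJ: "(s, J) \<in> ?R"
    then have J: "J \<in> nerve I A" and s: "s \<in> (\<Inter>i\<in>J. A i)" by (auto simp: blowup_incidence_def)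
    have "continuous_map (prod_topology (simplex_topology s) (simplex_topology J))
        (prod_topology (realization (\<Inter>i\<in>J. A i)) (simplex_topology J)) (\<lambda>z. z)"
      using continuous_map_compose[OF continuous_map_fst continuous_map_simplex_inclusion[OF s]]
      by (simp add: continuous_map_pairwise o_def continuous_map_snd)
    moreover have "continuous_map (prod_topology (realization (\<Inter>i\<in>J. A i)) (simplex_topology J)) ?P (Pair J)"
      unfolding P by (rule continuous_map_component_injection[OF J])
    ultimately have "continuous_map (prod_topology (simplex_topology s) (simplex_topology J)) ?B
        (?q \<circ> (Pair J \<circ> (\<lambda>z. z)))"
      using quotient_imp_continuous_map[OF q] by (intro continuous_map_compose)
    then
    have "continuous_map (prod_topology (simplex_topology s) (simplex_topology J)) ?B (\<lambda>z. ?q (J, z))"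
      by (simp add: o_def)
    then show "continuous_map (prod_topology (simplex_topology s) (simplex_topology J)) ?B
        (\<lambda>(x, p). ?q ({i. p i \<noteq> 0}, x, p))"
    proof (rule continuous_map_eq)
      fix z assume "z \<in> topspace (prod_topology (simplex_topology s) (simplex_topology J))"
      then have "(J, fst z, snd z) \<in> topspace ?P"
        using J s by (auto simp: topP realization_points_def)
      from glue[OF this] show "?q (J, z) = (case z of (x, p) \<Rightarrow> ?q ({i. p i \<noteq> 0}, x, p))"
        by (simp add: case_prod_unfold)
    qed
  qed
  show ?thesis
    unfolding homeomorphic_maps_def
  proof (intro conjI c1 c2 ballI)
    fix C assume "C \<in> topspace ?B"
    then have "C \<in> ?q ` topspace ?P" using quotient_imp_surjective_map[OF q] by simp
    then obtain z where z: "C = ?q z" "z \<in> topspace ?P" by (rule imageE)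
    obtain J x p where "z = (J, x, p)" by (rule prod_cases3)
    with z have "(J, x, p) \<in> topspace ?P" "C = ?q (J, x, p)" by simp_all
    then show "(case (rho_S C, rho_N C) of (x, p) \<Rightarrow> ?q ({i. p i \<noteq> 0}, x, p)) = C"
      by (simp add: rho glue)
  next
    fix z assume "z \<in> topspace (product_complex ?R)"
    then obtain J where "(J, fst z, snd z) \<in> topspace ?P" using mem[of "fst z" "snd z"] by auto
    from rho[OF suppP[OF this]]
    show "(rho_S (case z of (x, p) \<Rightarrow> ?q ({i. p i \<noteq> 0}, x, p)),
           rho_N (case z of (x, p) \<Rightarrow> ?q ({i. p i \<noteq> 0}, x, p))) = z"
      by (simp add: case_prod_unfold)
  qed
qed

theorem theorem3:
  fixes K :: "'a set set" and I :: "'i set" and A :: "'i \<Rightarrow> 'a set set"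
  assumes "abstract_simplicial_complex K"
    and "good_cover K I A"
  shows "homotopy_equivalence_map
           (blowup (realization K) I (\<lambda>i. topspace (realization (A i)))) (realization K) rho_S \<and>
         homotopy_equivalence_map
           (blowup (realization K) I (\<lambda>i. topspace (realization (A i)))) (realization (nerve I A)) rho_N"
proof -
  let ?U = "\<lambda>i. topspace (realization (A i))" and ?R = "blowup_incidence I A"
  have sub: "\<And>i. i \<in> I \<Longrightarrow> subcomplex (A i) K" and cover: "(\<Union>i\<in>I. A i) = K"
    using assms(2) by (auto simp: good_cover_def cover_by_subcomplexes_def)
  have cA: "abstract_simplicial_complex (A i)" if "i \<in> I" for i
    using sub[OF that] by (simp add: subcomplex_def)
  note nerve_complex = abstract_simplicial_complex_nerve[of I A]
  note homeo = homeomorphic_maps_blowup[OF assms(1) sub]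
  have J: "J \<subseteq> I" "finite J" "J \<noteq> {}" "(\<Inter>i\<in>J. A i) \<noteq> {}" if "J \<in> nerve I A" for J
    using that unfolding nerve_def by blast+
  have cJ: "abstract_simplicial_complex (\<Inter>i\<in>J. A i)" if "J \<in> nerve I A" for J
    using J[OF that] cA by (intro abstract_simplicial_complex_INT) auto
  have face: "(s', J) \<in> ?R" if "(s, J) \<in> ?R" "s' \<subseteq> s" "s' \<noteq> {}" for s s' J
    using that abstract_simplicial_complexD(3)[OF cJ, of J s s'] by (simp add: blowup_incidence_def)
  have face': "(s, J') \<in> ?R" if "(s, J) \<in> ?R" "J' \<subseteq> J" "J' \<noteq> {}" for s J J'
    using that abstract_simplicial_complexD(3)[OF nerve_complex, of J J'] by (auto simp: blowup_incidence_def)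
  have S: "homotopy_equivalence_map (product_complex ?R) (realization K) fst"
  proof (rule homotopy_equivalence_map_contractible_fibres[OF assms(1) face])
    show "s \<in> K" if "(s, J) \<in> ?R" for s J
      using that J[of J] cover by (fastforce simp: blowup_incidence_def)
    fix s assume s: "s \<in> K"
    let ?F = "{J. finite J \<and> J \<noteq> {} \<and> J \<subseteq> {i\<in>I. s \<in> A i}}"
    \<comment> \<open>A finite non-empty set of indices \<open>i\<close> with
      \<open>s \<in> A i\<close> is automatically in the nerve, as \<open>s\<close> witnesses the
      intersection; so the fibre is a full complex.\<close>
    have F: "?R `` {s} = ?F" by (auto simp: blowup_incidence_def nerve_def)
    obtain i where i: "i \<in> {i\<in>I. s \<in> A i}" using s cover by blast
    then show "contractible_space (realization (?R `` {s}))"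
      unfolding F by (rule contractible_full_complex)
    have "abstract_simplicial_complex ?F"
      by (auto simp: abstract_simplicial_complex_def intro: finite_subset)
    moreover have "{i} \<in> ?F" using i by blast
    ultimately show "realization_points (?R `` {s}) \<noteq> {}"
      unfolding F by (intro realization_points_nonempty) auto
  qed
  have fib: "?R\<inverse> `` {J} = (\<Inter>i\<in>J. A i)" if "J \<in> nerve I A" for J
    using that by (auto simp: blowup_incidence_def)
  \<comment> \<open>The same statement with the roles exchanged: the base is the nerve, and the
    fibre over \<open>J\<close> is the intersection of the \<open>A i\<close>, contractible because
    the cover is good.\<close>
  have "homotopy_equivalence_map (product_complex (?R\<inverse>)) (realization (nerve I A)) fst"
  proof (rule homotopy_equivalence_map_contractible_fibres[OF nerve_complex])
    fix J assume "J \<in> nerve I A"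
    then show "contractible_space (realization (?R\<inverse> `` {J}))" "realization_points (?R\<inverse> `` {J}) \<noteq> {}"
      using J[of J] cJ[of J] assms(2) realization_points_nonempty fib by (auto simp: good_cover_def)
  next
    show "(J', s) \<in> ?R\<inverse>" if "(J, s) \<in> ?R\<inverse>" "J' \<subseteq> J" "J' \<noteq> {}" for J s J'
      using face'[of s J J'] that by simp
    show "J \<in> nerve I A" if "(J, s) \<in> ?R\<inverse>" for J s
      using that by (simp add: blowup_incidence_def)
  qed
  from homotopy_equivalence_map_compose_homeomorphic[OF homeomorphic_maps_swap_product_complex this, of snd]
  have N: "homotopy_equivalence_map (product_complex ?R) (realization (nerve I A)) snd" by simp
  show ?thesis
    using homotopy_equivalence_map_compose_homeomorphic[OF homeo S]
      homotopy_equivalence_map_compose_homeomorphic[OF homeo N] by simp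
qed

end
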